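(* Let $n\ge1$ be an integer. For functions $f,g$ with $f\bar g\in\mathcal{TC}_{2n-1}$, $$\langle f,g\rangle_{\triangle_H}=\langle f,g\rangle_{\triangle,n}.$$ Moreover, the cubature formula $$\frac1{|\triangle_H|}\int_{\triangle_H}f(\mathbf t)\,d\mathbf t=\frac1{4n^3}\sum_{\mathbf j\in\Lambda_n}\lambda^{(n)}_{\mathbf j}f(\tfrac{\mathbf j}{4n})$$ is exact for all $f\in\mathcal{TC}_{2n-1}$. In particular, $\langle \mathsf{TC}_{\mathbf k},\mathsf{TC}_{\mathbf j}\rangle_{\triangle,n}=\delta_{\mathbf k,\mathbf j}/\lambda^{(n)}_{\mathbf k}$ for $\mathbf k,\mathbf j\in\Lambda_n$.
   Context: Let $\mathbb R^4_H=\{\mathbf t\in\mathbb R^4: t_1+t_2+t_3+t_4=0\}$ with 3-dimensional Lebesgue measure $d\mathbf t$, $\mathbb Z^4_H=\mathbb Z^4\cap\mathbb R^4_H$, $\mathbb H=\{\mathbf k\in\mathbb Z^4_H: k_1\equiv k_2\equiv k_3\equiv k_4\pmod4\}$, $\phi_{\mathbf k}(\mathbf t)=e^{\frac{\pi i}{2}\mathbf k\cdot\mathbf t}$. Let $\mathcal G=S_4$ act on $\mathbf t$ by permuting coordinates, $\mathbf t\mapsto\mathbf t\sigma$. Define $\mathsf{TC}_{\mathbf k}(\mathbf t)=\frac1{24}\sum_{\sigma\in\mathcal G}\phi_{\mathbf k}(\mathbf t\sigma)$. Let $\triangle_H=\{\mathbf t\in\mathbb R^4_H: t_1-t_2,\,t_2-t_3,\,t_3-t_4,\,t_1-t_4\in[0,1]\}$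 and $\langle f,g\rangle_{\triangle_H}=\frac1{|\triangle_H|}\int_{\triangle_H}f\bar g\,d\mathbf t$. Let $\Lambda_m=\{\mathbf k\in\mathbb H: k_4\le k_3\le k_2\le k_1\le k_4+4m\}$ and $\mathcal{TC}_m=\operatorname{span}\{\mathsf{TC}_{\mathbf k}:\mathbf k\in\Lambda_m\}$. For $\mathbf j\in\Lambda_n$ consider the four relations (a) $j_1=j_2$, (b) $j_2=j_3$, (c) $j_3=j_4$, (d) $j_1=j_4+4n$; define $\lambda^{(n)}_{\mathbf j}=24$ if none holds; $12$ if exactly one holds; if exactly two hold, $\lambda^{(n)}_{\mathbf j}=6$ when they are $\{(a),(c)\}$ or $\{(b),(d)\}$ and $\lambda^{(n)}_{\mathbf j}=4$ otherwise; $\lambda^{(n)}_{\mathbf j}=1$ if three hold. Define $\langle f,g\rangle_{\triangle,n}=\frac1{4n^3}\sum_{\mathbf j\in\Lambda_n}\lambda^{(n)}_{\mathbf j}f(\tfrac{\mathbf j}{4n})\overline{g(\tfrac{\mathbf j}{4n})}$. *)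

theory Defs
  imports "HOL-Analysis.Analysis" "HOL-Combinatorics.Permutations"
begin

text \<open>Points of R^4 are functions nat => real, only the coordinates 1..4 are used.
  Integer frequency vectors are functions nat => int, zero outside 1..4.\<close>

definition RH :: "(nat \<Rightarrow> real) set" where
  "RH = {t. t 1 + t 2 + t 3 + t 4 = 0}"

definition Hlat :: "(nat \<Rightarrow> int) set" where
  "Hlat = {k. (\<forall>i. i \<notin> {1..4} \<longrightarrow> k i = 0) \<and> k 1 + k 2 + k 3 + k 4 = 0 \<and>
              k 1 mod 4 = k 2 mod 4 \<and> k 2 mod 4 = k 3 mod 4 \<and> k 3 mod 4 = k 4 mod 4}"

definition phi :: "(nat \<Rightarrow> int) \<Rightarrow> (nat \<Rightarrow> real) \<Rightarrow> complex" where
  "phi k t = exp (\<i> * complex_of_real (pi / 2 * (\<Sum>i\<in>{1..4}. real_of_int (k i) * t i)))"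

definition S4 :: "(nat \<Rightarrow> nat) set" where
  "S4 = {\<sigma>. \<sigma> permutes {1..4}}"

definition TC :: "(nat \<Rightarrow> int) \<Rightarrow> (nat \<Rightarrow> real) \<Rightarrow> complex" where
  "TC k t = (1/24) * (\<Sum>\<sigma>\<in>S4. phi k (t \<circ> \<sigma>))"

definition triH :: "(nat \<Rightarrow> real) set" where
  "triH = {t \<in> RH. t 1 - t 2 \<in> {0..1} \<and> t 2 - t 3 \<in> {0..1} \<and> t 3 - t 4 \<in> {0..1} \<and> t 1 - t 4 \<in> {0..1}}"

definition Lam :: "nat \<Rightarrow> (nat \<Rightarrow> int) set" where
  "Lam m = {k \<in> Hlat. k 4 \<le> k 3 \<and> k 3 \<le> k 2 \<and> k 2 \<le> k 1 \<and> k 1 \<le> k 4 + 4 * int m}"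

definition inTC :: "nat \<Rightarrow> ((nat \<Rightarrow> real) \<Rightarrow> complex) \<Rightarrow> bool" where
  "inTC m f \<longleftrightarrow> (\<exists>c. \<forall>t\<in>RH. f t = (\<Sum>k\<in>Lam m. c k * TC k t))"

text \<open>Linear parametrisation of the hyperplane R^4_H by R^3 (the normalised integral is
  independent of the choice of linear parametrisation).\<close>
definition emb :: "real \<times> real \<times> real \<Rightarrow> (nat \<Rightarrow> real)" where
  "emb p = (\<lambda>i. if i = 1 then fst p else if i = 2 then fst (snd p) else if i = 3 then snd (snd p)
              else if i = 4 then - (fst p + fst (snd p) + snd (snd p)) else 0)"

definition triH3 :: "(real \<times> real \<times> real) set" where
  "triH3 = emb -` triH"

definition avg_tri :: "((nat \<Rightarrow> real) \<Rightarrow> complex) \<Rightarrow> complex" where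
  "avg_tri f = integral triH3 (f \<circ> emb) / complex_of_real (measure lebesgue triH3)"

definition ip_tri :: "((nat \<Rightarrow> real) \<Rightarrow> complex) \<Rightarrow> ((nat \<Rightarrow> real) \<Rightarrow> complex) \<Rightarrow> complex" where
  "ip_tri f g = avg_tri (\<lambda>t. f t * cnj (g t))"

definition lam :: "nat \<Rightarrow> (nat \<Rightarrow> int) \<Rightarrow> real" where
  "lam n j = (let A = (j 1 = j 2); B = (j 2 = j 3); C = (j 3 = j 4); D = (j 1 = j 4 + 4 * int n);
      cnt = of_bool A + of_bool B + of_bool C + (of_bool D :: nat) in
      if cnt = 0 then 24 else if cnt = 1 then 12
      else if cnt = 2 then (if (A \<and> C) \<or> (B \<and> D) then 6 else 4)
      else if cnt = 3 then 1 else 0)"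

definition pt :: "nat \<Rightarrow> (nat \<Rightarrow> int) \<Rightarrow> (nat \<Rightarrow> real)" where
  "pt n j = (\<lambda>i. real_of_int (j i) / (4 * real n))"

definition cub :: "nat \<Rightarrow> ((nat \<Rightarrow> real) \<Rightarrow> complex) \<Rightarrow> complex" where
  "cub n f = (1 / (4 * real n ^ 3)) * (\<Sum>j\<in>Lam n. complex_of_real (lam n j) * f (pt n j))"

definition ip_disc :: "nat \<Rightarrow> ((nat \<Rightarrow> real) \<Rightarrow> complex) \<Rightarrow> ((nat \<Rightarrow> real) \<Rightarrow> complex) \<Rightarrow> complex" where
  "ip_disc n f g = cub n (\<lambda>t. f t * cnj (g t))"

end

theory Submission
  imports Defs
begin

text \<open>
  Translations by integer vectors of sum zero together with coordinate permutations form the affine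
  Weyl group of type \<open>A\<^sub>3\<close>, and the simplex \<open>triH\<close> is a closed fundamental domain of it. The functions
  \<open>TC k\<close> are invariant under this group, so both sides of the cubature formula unfold: the weights
  \<open>lam n j\<close> are the orbit sizes of \<open>j / (4 n)\<close> modulo translations, hence the cubature sum is the average
  over the finite group \<open>Hlat\<close> modulo \<open>4 n\<close> times the translation lattice; likewise the integral over the
  simplex is the average over the unit cube in the coordinates of \<open>emb\<close>. On the finite group \<open>phi k\<close> has
  mean zero unless \<open>k\<close> lies in \<open>4 n\<close> times the translation lattice, and in \<open>Lam (2 n - 1)\<close> only
  \<open>k = 0\<close> does. Two elements of \<open>Lam n\<close> are congruent up to a permutation only if they are equal,
  which gives the discrete orthogonality.
\<close>

subsection \<open>The affine Weyl group on the alcove\<close>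

text \<open>The duality behind both sides: the entries of \<open>k\<close> agree modulo 4, so
  \<open>k\<close> is a multiple of (1, 1, 1, 1) plus 4 times an integer vector, and
  \<open>phi k\<close> does not see integer translations of sum zero. Points on the walls of the
  alcove shape the argument. In the discrete sum they carry weight, so every orbit is counted
  exactly through its stabiliser; in the integral they lie on countably many planes and form a null
  set. The factor \<open>4 * n ^ 3\<close> is the order of the finite group: three quotients below
  \<open>n\<close> and one common residue modulo 4. The degree \<open>2 * n - 1\<close> is sharp: 4n
  (1, 0, 0, -1) lies in \<open>Lam (2 * n)\<close>, its exponential is 1 at every node, but its
  integral average is 0. For the same reason discrete orthogonality is no instance of exactness:
  products of two functions with frequencies in \<open>Lam n\<close> can reach degree 2n, where
  aliasing occurs. The value \<open>1 / lam n k\<close> comes from counting the aliased pairs. On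
  the continuous side only nonzero frequencies are unfolded; the frequency 0 is settled by the
  normalisation.\<close>

lemma S4_comp: "\<sigma> \<in> S4 \<Longrightarrow> \<tau> \<in> S4 \<Longrightarrow> \<sigma> \<circ> \<tau> \<in> S4"
  by (simp add: S4_def permutes_compose)

lemma S4_inv: "\<sigma> \<in> S4 \<Longrightarrow> inv \<sigma> \<in> S4"
  by (simp add: S4_def permutes_inv)

lemma S4_id: "id \<in> S4"
  by (simp add: S4_def permutes_id)

lemma finite_S4: "finite S4"
  by (simp add: S4_def finite_permutations)

lemma card_S4: "card S4 = 24"
  by (simp add: S4_def card_permutations[OF refl] fact_numeral)

lemma S4_range: "\<sigma> \<in> S4 \<Longrightarrow> i \<in> {1..4} \<Longrightarrow> \<sigma> i \<in> {1..4}"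
  unfolding S4_def by (metis mem_Collect_eq permutes_in_image)

lemma S4_outside: "\<sigma> \<in> S4 \<Longrightarrow> i \<notin> {1..4} \<Longrightarrow> \<sigma> i = i"
  unfolding S4_def by (simp add: permutes_not_in)

lemma S4_bij: "\<sigma> \<in> S4 \<Longrightarrow> bij \<sigma>"
  unfolding S4_def using permutes_bij by blast

lemma S4_inv_comp [simp]:
  assumes "\<sigma> \<in> S4"
  shows "\<sigma> \<circ> inv \<sigma> = id" "inv \<sigma> \<circ> \<sigma> = id" "\<sigma> (inv \<sigma> i) = i" "inv \<sigma> (\<sigma> i) = i"
  using S4_bij[OF assms] by (auto simp: fun_eq_iff bij_is_surj surj_f_inv_f bij_is_inj)

lemma sum_14: "sum f {1..4::nat} = f 1 + f 2 + f 3 + (f 4 :: 'a::comm_monoid_add)"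
  by (simp add: numeral_eq_Suc add.assoc)

lemma sum_S4: "\<sigma> \<in> S4 \<Longrightarrow> (\<Sum>i\<in>{1..4}. f (\<sigma> i)) = sum f {1..4}"
  unfolding S4_def using sum.permute[of \<sigma> "{1..4}" f] by (simp add: o_def)

lemma sum_over_S4_left:
  assumes "\<sigma> \<in> S4"
  shows "(\<Sum>\<tau>\<in>S4. f (\<sigma> \<circ> \<tau>)) = sum f S4"
  by (rule sum.reindex_bij_witness[of _ "\<lambda>\<tau>. inv \<sigma> \<circ> \<tau>" "\<lambda>\<tau>. \<sigma> \<circ> \<tau>"])
     (use assms in \<open>auto simp: S4_comp S4_inv comp_assoc[symmetric]\<close>)

lemma sum_over_S4_inv: "(\<Sum>\<tau>\<in>S4. f (inv \<tau>)) = sum f S4"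
  by (rule sum.reindex_bij_witness[of _ inv inv]) (auto simp: S4_inv inv_inv_eq S4_bij)

lemma ball_14: "(\<forall>i\<in>{1..4::nat}. P i) \<longleftrightarrow> P 1 \<and> P 2 \<and> P 3 \<and> P 4"
proof -
  have "{1..4::nat} = {1,2,3,4}" by auto
  then show ?thesis by simp
qed

lemma S4_I:
  assumes "{a, b, c, d} = {1, 2, 3, 4 :: nat}"
  shows "(\<lambda>i. if i = 1 then a else if i = 2 then b else if i = 3 then c else if i = 4 then d else i) \<in> S4"
    (is "?s \<in> S4")
proof -
  have e: "{1..4::nat} = {1,2,3,4}" by auto
  have "?s ` {1,2,3,4} = {a,b,c,d}" by auto
  then have im: "?s ` {1..4} = {1..4}" unfolding e assms .
  then have "bij_betw ?s {1..4} {1..4}"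
    by (simp only: bij_betw_def finite_surj_inj[OF finite_atLeastAtMost] order_refl)
  then show ?thesis unfolding S4_def by (auto intro!: bij_imp_permutes)
qed

lemma sorting_perm:
  fixes r :: "nat \<Rightarrow> real"
  obtains \<sigma> where "\<sigma> \<in> S4" "r (\<sigma> 1) \<ge> r (\<sigma> 2)" "r (\<sigma> 2) \<ge> r (\<sigma> 3)" "r (\<sigma> 3) \<ge> r (\<sigma> 4)"
proof -
  define xs where "xs = sort_key (\<lambda>i. - r i) [1,2,3,4::nat]"
  have len: "length xs = 4" and st: "set xs = {1,2,3,4}" and so: "sorted (map (\<lambda>i. - r i) xs)"
    unfolding xs_def by (auto simp del: sort_key_simps)
  from len obtain a b c d where xs: "xs = [a,b,c,d]"
    by (auto simp: numeral_eq_Suc length_Suc_conv)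
  show ?thesis
    by (rule that[OF S4_I[of a b c d]]) (use st so in \<open>auto simp: xs\<close>)
qed

section \<open>Existence and uniqueness of representatives in the alcove\<close>

text \<open>Between points of \<open>RH\<close> the integer difference has sum zero automatically,
  so this is congruence modulo the translation lattice.\<close>

definition latt_eq :: "(nat \<Rightarrow> real) \<Rightarrow> (nat \<Rightarrow> real) \<Rightarrow> bool" where
  "latt_eq x y \<longleftrightarrow> (\<forall>i\<in>{1..4}. x i - y i \<in> \<int>)"

text \<open>The coordinates decrease and spread over at most 1, so the four floors decrease and
  differ by at most 1: the first r of them are q + 1 and the others are q, with r < 4. Their sum 4q
  + r therefore determines each floor, in particular its sign.\<close>

lemma triH_floor_sum:
  assumes "x \<in> triH" "i \<in> {1..4}"
  shows "0 \<le> x i + s \<longleftrightarrow> int i - 4 \<le> (\<Sum>l\<in>{1..4}. \<lfloor>x l + s\<rfloor>)"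
proof -
  have o: "x 2 \<le> x 1" "x 3 \<le> x 2" "x 4 \<le> x 3" "x 1 \<le> x 4 + 1"
    using assms(1) by (auto simp: triH_def)
  have "\<lfloor>x 2 + s\<rfloor> \<le> \<lfloor>x 1 + s\<rfloor>" "\<lfloor>x 3 + s\<rfloor> \<le> \<lfloor>x 2 + s\<rfloor>" "\<lfloor>x 4 + s\<rfloor> \<le> \<lfloor>x 3 + s\<rfloor>"
    using o by (auto intro!: floor_mono)
  moreover have "\<lfloor>x 1 + s\<rfloor> \<le> \<lfloor>x 4 + s\<rfloor> + 1"
    using o by linarith
  moreover have "i = 1 \<or> i = 2 \<or> i = 3 \<or> i = 4" using assms(2) by auto
  moreover have "0 \<le> x i + s \<longleftrightarrow> 0 \<le> \<lfloor>x i + s\<rfloor>" by simp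
  ultimately show ?thesis unfolding sum_14
    by (elim disjE) (simp_all only: of_nat_1 of_nat_numeral, linarith+)
qed

text \<open>The step function \<open>s \<mapsto> \<Sum>i. \<lfloor>x i + s\<rfloor>\<close> is invariant under permutations and
  under integer shifts of total sum zero, and it determines a point of the alcove.\<close>
lemma triH_unique:
  assumes x: "x \<in> triH" and y: "y \<in> triH" and s: "\<sigma> \<in> S4" and e: "latt_eq y (x \<circ> \<sigma>)"
    and i: "i \<in> {1..4}"
  shows "x i = y i"
proof -
  have "\<forall>i\<in>{1..4}. \<exists>m. y i = x (\<sigma> i) + of_int m"
  proof
    fix i :: nat assume "i \<in> {1..4}"
    then have "y i - x (\<sigma> i) \<in> \<int>" using e by (auto simp: latt_eq_def)
    then obtain m where "y i - x (\<sigma> i) = of_int m" by (elim Ints_cases)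
    then have "y i = x (\<sigma> i) + of_int m" by linarith
    then show "\<exists>m. y i = x (\<sigma> i) + of_int m" ..
  qed
  then obtain m where m: "\<And>i. i \<in> {1..4} \<Longrightarrow> y i = x (\<sigma> i) + of_int (m i)"
    unfolding bchoice_iff by blast
  have "sum x {1..4} = 0" "sum y {1..4} = 0"
    using x y unfolding sum_14 by (auto simp: triH_def RH_def)
  moreover have "sum y {1..4} = (\<Sum>i\<in>{1..4}. x (\<sigma> i)) + of_int (\<Sum>i\<in>{1..4}. m i)"
    by (simp add: m sum.distrib)
  \<comment> \<open>Both points have coordinate sum zero, so the integer shifts cancel in total;
    this is what makes the floor sums of \<open>x\<close> and \<open>y\<close> equal.\<close>
  ultimately have m0: "(\<Sum>i\<in>{1..4}. m i) = 0"
    unfolding sum_S4[OF s] by (metis add_0 of_int_eq_0_iff)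
  have "(\<Sum>l\<in>{1..4}. \<lfloor>y l + s\<rfloor>) = (\<Sum>l\<in>{1..4}. \<lfloor>x l + s\<rfloor>)" for s
  proof -
    have "\<lfloor>y l + s\<rfloor> = \<lfloor>x (\<sigma> l) + s\<rfloor> + m l" if "l \<in> {1..4}" for l
    proof -
      have "y l + s = (x (\<sigma> l) + s) + of_int (m l)" using m[OF that] by simp
      then show ?thesis by (metis floor_add_int)
    qed
    then have "(\<Sum>l\<in>{1..4}. \<lfloor>y l + s\<rfloor>) = (\<Sum>l\<in>{1..4}. \<lfloor>x (\<sigma> l) + s\<rfloor>) + (\<Sum>l\<in>{1..4}. m l)"
      by (simp add: sum.distrib)
    then show ?thesis using m0 sum_S4[OF \<open>\<sigma> \<in> S4\<close>, of "\<lambda>l. \<lfloor>x l + s\<rfloor>"] by simp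
  qed
  then have "0 \<le> x i + s \<longleftrightarrow> 0 \<le> y i + s" for s
    using triH_floor_sum[OF x i] triH_floor_sum[OF y i] by simp
  \<comment> \<open>At these two values of \<open>s\<close> the equivalence gives
    \<open>x i \<le> y i\<close> and \<open>y i \<le> x i\<close>.\<close>
  from this[of "- x i"] this[of "- y i"] show ?thesis by simp
qed

text \<open>Moving the largest coordinate to the end and lowering it by 1 preserves the chain of
  inequalities, since \<open>x 1 - 1 \<le> x 4\<close>, and lowers the sum by 1. After
  \<open>d\<close> such moves the sum is zero and the point lies in the alcove.\<close>

lemma triH_rotate:
  fixes d :: nat
  assumes "x 2 \<le> x 1" "x 3 \<le> x 2" "x 4 \<le> x 3" "x 1 \<le> x 4 + 1" "x 1 + x 2 + x 3 + x 4 = real d"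
  shows "\<exists>\<sigma>\<in>S4. \<exists>y\<in>triH. latt_eq y (x \<circ> \<sigma>)"
  using assms
proof (induction d arbitrary: x)
  case 0
  then have "x \<in> triH" by (auto simp: triH_def RH_def)
  then show ?case by (intro bexI[OF _ S4_id] bexI[of _ x]) (auto simp: latt_eq_def)
next
  case (Suc d)
  define \<rho> :: "nat \<Rightarrow> nat" where
    "\<rho> = (\<lambda>i. if i = 1 then 2 else if i = 2 then 3 else if i = 3 then 4 else if i = 4 then 1 else i)"
  have rho: "\<rho> \<in> S4" unfolding \<rho>_def by (rule S4_I) auto
  \<comment> \<open>This is the point (x 2, x 3, x 4, x 1 - 1).\<close>
  define z where "z i = x (\<rho> i) - of_bool (i = 4)" for i
  have "\<exists>\<sigma>\<in>S4. \<exists>y\<in>triH. latt_eq y (z \<circ> \<sigma>)"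
    by (rule Suc.IH) (use Suc.prems in \<open>auto simp: z_def \<rho>_def\<close>)
  then obtain \<sigma> y where s: "\<sigma> \<in> S4" and y: "y \<in> triH" and e: "latt_eq y (z \<circ> \<sigma>)" by blast
  have "y i - x (\<rho> (\<sigma> i)) \<in> \<int>" if "i \<in> {1..4}" for i
  proof -
    have "y i - z (\<sigma> i) \<in> \<int>" using e that by (auto simp: latt_eq_def)
    then have "(y i - z (\<sigma> i)) - of_bool (\<sigma> i = 4) \<in> \<int>" by (rule Ints_diff) auto
    then show ?thesis by (simp add: z_def algebra_simps)
  qed
  then show ?case using S4_comp[OF rho s] y
    by (intro bexI[of _ "\<rho> \<circ> \<sigma>"] bexI[of _ y]) (auto simp: latt_eq_def)
qed

text \<open>The sorted fractional parts decrease and spread over less than 1. As \<open>t\<close>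
  has sum zero, they add up to minus the sum of the floors, a natural number, so
  \<open>triH_rotate\<close> applies.\<close>

lemma triH_exists:
  assumes t: "t \<in> RH"
  shows "\<exists>\<sigma>\<in>S4. \<exists>y\<in>triH. latt_eq y (t \<circ> \<sigma>)"
proof -
  obtain \<tau> where tau: "\<tau> \<in> S4"
    and o: "frac (t (\<tau> 1)) \<ge> frac (t (\<tau> 2))" "frac (t (\<tau> 2)) \<ge> frac (t (\<tau> 3))"
      "frac (t (\<tau> 3)) \<ge> frac (t (\<tau> 4))"
    using sorting_perm[of "\<lambda>i. frac (t i)"] by blast
  define x where "x i = frac (t (\<tau> i))" for i
  have fr: "0 \<le> x i" "x i < 1" for i by (auto simp: x_def frac_lt_1)
  have "sum (\<lambda>i. frac (t (\<tau> i))) {1..4} = sum (\<lambda>i. frac (t i)) {1..4}"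
    using sum_S4[OF tau, of "\<lambda>i. frac (t i)"] by simp
  also have "\<dots> = of_int (- sum (\<lambda>i. \<lfloor>t i\<rfloor>) {1..4})"
    using t unfolding sum_14 by (simp add: RH_def frac_def)
  finally have sx: "x 1 + x 2 + x 3 + x 4 = of_int (- sum (\<lambda>i. \<lfloor>t i\<rfloor>) {1..4})"
    unfolding sum_14 x_def .
  define d where "d = nat (- sum (\<lambda>i. \<lfloor>t i\<rfloor>) {1..4})"
  have "- sum (\<lambda>i. \<lfloor>t i\<rfloor>) {1..4} \<ge> 0"
    using sx fr(1)[of 1] fr(1)[of 2] fr(1)[of 3] fr(1)[of 4] by linarith
  then have sd: "x 1 + x 2 + x 3 + x 4 = real d"
    using sx unfolding d_def by simp
  have "\<exists>\<sigma>\<in>S4. \<exists>y\<in>triH. latt_eq y (x \<circ> \<sigma>)"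
    by (rule triH_rotate[where d = d])
      (use o sd fr(1)[of 4] fr(2)[of 1] in \<open>auto simp: x_def[symmetric]\<close>)
  then obtain \<sigma> y where s: "\<sigma> \<in> S4" and y: "y \<in> triH" and e: "latt_eq y (x \<circ> \<sigma>)" by blast
  have "y i - t (\<tau> (\<sigma> i)) \<in> \<int>" if "i \<in> {1..4}" for i
  proof -
    have "y i - x (\<sigma> i) \<in> \<int>" using e that by (auto simp: latt_eq_def)
    then have "(y i - x (\<sigma> i)) - of_int \<lfloor>t (\<tau> (\<sigma> i))\<rfloor> \<in> \<int>" by (rule Ints_diff) auto
    then show ?thesis by (simp add: x_def frac_def)
  qed
  then show ?thesis using S4_comp[OF tau s] y
    by (intro bexI[of _ "\<tau> \<circ> \<sigma>"] bexI[of _ y]) (auto simp: latt_eq_def)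
qed

section \<open>Orders of the stabilisers of alcove points\<close>

text \<open>The explicit 24 terms turn the count in \<open>card_young\<close> into a finite Boolean
  evaluation.\<close>

lemma sum_over_S4:
  fixes f :: "nat \<Rightarrow> nat \<Rightarrow> nat \<Rightarrow> nat \<Rightarrow> 'a::comm_monoid_add"
  shows "(\<Sum>\<sigma>\<in>S4. f (\<sigma> 1) (\<sigma> 2) (\<sigma> 3) (\<sigma> 4)) =
    f 1 2 3 4 + f 1 2 4 3 + f 1 3 2 4 + f 1 3 4 2 + f 1 4 2 3 + f 1 4 3 2 +
    f 2 1 3 4 + f 2 1 4 3 + f 2 3 1 4 + f 2 3 4 1 + f 2 4 1 3 + f 2 4 3 1 +
    f 3 1 2 4 + f 3 1 4 2 + f 3 2 1 4 + f 3 2 4 1 + f 3 4 1 2 + f 3 4 2 1 +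
    f 4 1 2 3 + f 4 1 3 2 + f 4 2 1 3 + f 4 2 3 1 + f 4 3 1 2 + f 4 3 2 1"
proof -
  have e: "{1..4::nat} = insert 1 (insert 2 (insert 3 {4}))" by auto
  show ?thesis
    unfolding S4_def e
    by (simp add: sum_over_permutations_insert transpose_def ac_simps del: One_nat_def)
qed

text \<open>\<open>A\<close>, \<open>B\<close>, \<open>C\<close>, \<open>D\<close> stand for the
  four walls of the alcove, joining the indices in the cycle 1-2-3-4-1. Two indices are related
  exactly when one of the two arcs between them consists of active walls. The permutations counted
  form the Young subgroup of the classes of \<open>R\<close>, of order 1, 2, 4, 6 or 24, and the
  second factor is the corresponding index 24, 12, 6, 4 or 1.\<close>

lemma card_young:
  fixes R :: "nat \<Rightarrow> nat \<Rightarrow> bool"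
  assumes rf: "\<And>i. R i i" and sym: "\<And>i k. R i k = R k i"
    and R: "R 1 2 \<longleftrightarrow> A \<or> (B \<and> C \<and> D)" "R 2 3 \<longleftrightarrow> B \<or> (C \<and> D \<and> A)" "R 3 4 \<longleftrightarrow> C \<or> (D \<and> A \<and> B)"
      "R 1 4 \<longleftrightarrow> D \<or> (A \<and> B \<and> C)" "R 1 3 \<longleftrightarrow> (A \<and> B) \<or> (C \<and> D)" "R 2 4 \<longleftrightarrow> (B \<and> C) \<or> (D \<and> A)"
    and n: "\<not> (A \<and> B \<and> C \<and> D)"
  shows "real (card {\<sigma>\<in>S4. \<forall>i\<in>{1..4}. R (\<sigma> i) i}) *
    (let cnt = of_bool A + of_bool B + of_bool C + (of_bool D :: nat) in
      if cnt = 0 then 24 else if cnt = 1 then 12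
      else if cnt = 2 then (if (A \<and> C) \<or> (B \<and> D) then 6 else 4)
      else if cnt = 3 then 1 else 0) = 24"
proof -
  have "card {\<sigma>\<in>S4. \<forall>i\<in>{1..4}. R (\<sigma> i) i} = (\<Sum>\<sigma>\<in>S4. of_bool (\<forall>i\<in>{1..4}. R (\<sigma> i) i))"
    using finite_S4 by (simp add: of_bool_def sum.If_cases Int_def)
  then have c: "card {\<sigma>\<in>S4. \<forall>i\<in>{1..4}. R (\<sigma> i) i} =
     (\<Sum>\<sigma>\<in>S4. of_bool (R (\<sigma> 1) 1 \<and> R (\<sigma> 2) 2 \<and> R (\<sigma> 3) 3 \<and> R (\<sigma> 4) 4))"
    unfolding ball_14 .
  have sy: "R 2 1 = R 1 2" "R 3 1 = R 1 3" "R 4 1 = R 1 4" "R 3 2 = R 2 3" "R 4 2 = R 2 4" "R 4 3 = R 3 4"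
    using sym by auto
  show ?thesis
    unfolding c sum_over_S4[of "\<lambda>a b c d. of_bool (R a 1 \<and> R b 2 \<and> R c 3 \<and> R d 4)"] sy R Let_def
    using n by (cases A; cases B; cases C; cases D) (simp_all add: rf)
qed

subsection \<open>Folding the lattice onto the alcove\<close>

text \<open>This form treats the four coordinates alike, which makes closure under permutations
  visible.\<close>

lemma Hlat_iff:
  "k \<in> Hlat \<longleftrightarrow> (\<forall>i. i \<notin> {1..4} \<longrightarrow> k i = 0) \<and> (\<Sum>i\<in>{1..4}. k i) = 0 \<and>
    (\<forall>i\<in>{1..4}. \<forall>l\<in>{1..4}. k i mod 4 = k l mod 4)"
  unfolding Hlat_def sum_14 ball_14 by auto

lemma Hlat_comp:
  assumes "k \<in> Hlat" "\<sigma> \<in> S4"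
  shows "k \<circ> \<sigma> \<in> Hlat"
  unfolding Hlat_iff
proof (intro conjI allI impI ballI)
  fix i assume "i \<notin> {1..4::nat}"
  then show "(k \<circ> \<sigma>) i = 0"
    using assms S4_outside[OF assms(2)] by (auto simp: Hlat_iff)
next
  show "sum (k \<circ> \<sigma>) {1..4} = 0"
    using assms(1) sum_S4[OF assms(2), of k] by (simp add: Hlat_iff o_def)
next
  fix i l :: nat assume "i \<in> {1..4}" "l \<in> {1..4}"
  then show "(k \<circ> \<sigma>) i mod 4 = (k \<circ> \<sigma>) l mod 4"
    using assms(1) S4_range[OF assms(2)] unfolding Hlat_iff o_def by blast
qed

lemma RH_comp: "t \<in> RH \<Longrightarrow> \<sigma> \<in> S4 \<Longrightarrow> t \<circ> \<sigma> \<in> RH"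
  using sum_S4[of \<sigma> t] unfolding RH_def sum_14 by auto

section \<open>Invariance of exponentials and of their orbit averages\<close>

lemma phi_cis: "phi k t = cis (pi / 2 * (\<Sum>i\<in>{1..4}. real_of_int (k i) * t i))"
  by (simp add: phi_def cis_conv_exp)

lemma phi_comp:
  assumes "\<sigma> \<in> S4"
  shows "phi k (t \<circ> \<sigma>) = phi (k \<circ> inv \<sigma>) t"
proof -
  have "(\<Sum>i\<in>{1..4}. real_of_int (k (inv \<sigma> (\<sigma> i))) * t (\<sigma> i)) =
      (\<Sum>i\<in>{1..4}. real_of_int (k (inv \<sigma> i)) * t i)"
    by (rule sum_S4[OF assms])
  then show ?thesis using assms by (simp add: phi_cis)
qed

text \<open>With the permutation on the frequency, \<open>TC k\<close> is a combination of
  exponentials at one common point, to which character sums apply.\<close>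

lemma TC_alt: "TC k t = (1/24) * (\<Sum>\<sigma>\<in>S4. phi (k \<circ> \<sigma>) t)"
  unfolding TC_def sum_over_S4_inv[of "\<lambda>\<sigma>. phi (k \<circ> \<sigma>) t", symmetric]
  by (simp add: phi_comp)

lemma TC_comp: "\<sigma> \<in> S4 \<Longrightarrow> TC k (t \<circ> \<sigma>) = TC k t"
  unfolding TC_def comp_assoc using sum_over_S4_left[of \<sigma> "\<lambda>\<tau>. phi k (t \<circ> \<tau>)"] by simp

text \<open>Writing \<open>k i = k 4 + 4 * c i\<close>, the product of \<open>k\<close> with an
  integer vector \<open>m\<close> of sum zero is four times an integer; the factor pi/2 turns this
  into a multiple of 2 pi.\<close>

lemma phi_periodic:
  assumes k: "k \<in> Hlat" and t: "t \<in> RH" "t' \<in> RH" and e: "latt_eq t' t"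
  shows "phi k t' = phi k t"
proof -
  have "\<forall>i\<in>{1..4}. \<exists>m. t' i - t i = of_int m"
    using e by (auto simp: latt_eq_def elim!: Ints_cases)
  then obtain m where m: "\<And>i. i \<in> {1..4} \<Longrightarrow> t' i - t i = of_int (m i)"
    unfolding bchoice_iff by blast
  have "\<forall>i\<in>{1..4}. \<exists>c. k i = k 4 + 4 * c"
  proof
    fix i :: nat assume i: "i \<in> {1..4}"
    have "(4::nat) \<in> {1..4}" by simp
    then have "k i mod 4 = k 4 mod 4" using k i unfolding Hlat_iff by blast
    then have "4 dvd k i - k 4" by (simp add: mod_eq_dvd_iff)
    then obtain c where "k i - k 4 = 4 * c" by (elim dvdE)
    then have "k i = k 4 + 4 * c" by simp
    then show "\<exists>c. k i = k 4 + 4 * c" ..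
  qed
  then obtain c where c: "\<And>i. i \<in> {1..4} \<Longrightarrow> k i = k 4 + 4 * c i"
    unfolding bchoice_iff by blast
  have "(\<Sum>i\<in>{1..4}. t' i) = 0" "(\<Sum>i\<in>{1..4}. t i) = 0"
    using t unfolding sum_14 by (auto simp: RH_def)
  then have m0: "(\<Sum>i\<in>{1..4}. real_of_int (m i)) = 0"
    using m by (simp add: sum_subtractf flip: m)
  have "(\<Sum>i\<in>{1..4}. real_of_int (k i) * t' i) - (\<Sum>i\<in>{1..4}. real_of_int (k i) * t i)
      = (\<Sum>i\<in>{1..4}. real_of_int (k i) * of_int (m i))"
    unfolding sum_subtractf[symmetric]
    by (rule sum.cong) (auto simp: m[symmetric] algebra_simps)
  also have "\<dots> = (\<Sum>i\<in>{1..4}. of_int (k 4) * of_int (m i) + 4 * of_int (c i * m i))"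
    by (rule sum.cong[OF refl]) (subst c, auto simp: algebra_simps)
  also have "\<dots> = of_int (k 4) * (\<Sum>i\<in>{1..4}. of_int (m i)) + 4 * of_int (\<Sum>i\<in>{1..4}. c i * m i)"
    unfolding sum.distrib sum_distrib_left of_int_sum ..
  finally have "(\<Sum>i\<in>{1..4}. real_of_int (k i) * t' i) =
      (\<Sum>i\<in>{1..4}. real_of_int (k i) * t i) + 4 * of_int (\<Sum>i\<in>{1..4}. c i * m i)"
    unfolding m0 by linarith
  then have "phi k t' = cis (pi / 2 * (\<Sum>i\<in>{1..4}. real_of_int (k i) * t i) +
      2 * pi * of_int (\<Sum>i\<in>{1..4}. c i * m i))"
    unfolding phi_cis by (simp add: algebra_simps)
  also have "\<dots> = phi k t"
    unfolding cis_mult[symmetric] phi_cis using cis_multiple_2pi[of "of_int (\<Sum>i\<in>{1..4}. c i * m i)"]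
    by (simp del: of_int_sum)
  finally show ?thesis .
qed

lemma latt_eq_comp: "latt_eq t' t \<Longrightarrow> \<sigma> \<in> S4 \<Longrightarrow> latt_eq (t' \<circ> \<sigma>) (t \<circ> \<sigma>)"
  unfolding latt_eq_def using S4_range by auto

lemma TC_periodic:
  assumes k: "k \<in> Hlat" and t: "t \<in> RH" "t' \<in> RH" and e: "latt_eq t' t"
  shows "TC k t' = TC k t"
  unfolding TC_def
  by (intro arg_cong2[where f = "(*)"] refl sum.cong)
    (rule phi_periodic[OF k RH_comp[OF t(1)] RH_comp[OF t(2)] latt_eq_comp[OF e]])

section \<open>Congruence classes of frequencies and their representatives in
  \<open>Lam n\<close>\<close>

text \<open>On \<open>Hlat\<close> this is congruence modulo 4n times the translation lattice, that
  is, \<open>latt_eq\<close> of the scaled points (see \<open>latt_eq_pt\<close>).\<close>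

definition latcong :: "nat \<Rightarrow> (nat \<Rightarrow> int) \<Rightarrow> (nat \<Rightarrow> int) \<Rightarrow> bool" where
  "latcong n j k \<longleftrightarrow> (\<forall>i\<in>{1..4}. 4 * int n dvd j i - k i)"

lemma latcong_refl: "latcong n j j"
  by (simp add: latcong_def)

lemma latcong_sym: "latcong n j k \<Longrightarrow> latcong n k j"
  by (simp add: latcong_def dvd_diff_commute)

lemma latcong_trans:
  assumes "latcong n j k" "latcong n k l"
  shows "latcong n j l"
  unfolding latcong_def
proof
  fix i :: nat assume "i \<in> {1..4}"
  then have "4 * int n dvd (j i - k i) + (k i - l i)"
    using assms unfolding latcong_def by (blast intro: dvd_add)
  then show "4 * int n dvd j i - l i" by simp
qed

lemma latcong_comp: "latcong n j k \<Longrightarrow> \<sigma> \<in> S4 \<Longrightarrow> latcong n (j \<circ> \<sigma>) (k \<circ> \<sigma>)"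
  unfolding latcong_def using S4_range by auto

lemma latcong_comp_iff: "\<sigma> \<in> S4 \<Longrightarrow> latcong n (j \<circ> \<sigma>) (k \<circ> \<sigma>) \<longleftrightarrow> latcong n j k"
  using latcong_comp[of n "j \<circ> \<sigma>" "k \<circ> \<sigma>" "inv \<sigma>"] latcong_comp[of n j k \<sigma>]
  by (auto simp: S4_inv comp_assoc)

lemma pt_comp: "pt n (j \<circ> \<sigma>) = pt n j \<circ> \<sigma>"
  by (simp add: pt_def fun_eq_iff)

lemma pt_RH: "j \<in> Hlat \<Longrightarrow> pt n j \<in> RH"
  unfolding Hlat_def RH_def pt_def
  by (simp add: add_divide_distrib[symmetric] flip: of_int_add)

lemma latt_eq_pt:
  assumes "n \<ge> 1"
  shows "latt_eq (pt n j) (pt n k) \<longleftrightarrow> latcong n j k"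
proof -
  have "pt n j i - pt n k i \<in> \<int> \<longleftrightarrow> 4 * int n dvd j i - k i" for i
  proof -
    have "pt n j i - pt n k i = of_int (j i - k i) / of_int (4 * int n)"
      by (simp add: pt_def diff_divide_distrib)
    also have "\<dots> \<in> \<int> \<longleftrightarrow> 4 * int n dvd j i - k i"
    proof
      assume "of_int (j i - k i) / of_int (4 * int n) \<in> (\<int> :: real set)"
      then obtain m where "of_int (j i - k i) / of_int (4 * int n) = (of_int m :: real)"
        by (elim Ints_cases)
      then have "of_int (j i - k i) = (of_int (4 * int n * m) :: real)"
        using assms by (simp add: field_simps)
      then show "4 * int n dvd j i - k i" by (simp only: of_int_eq_iff dvd_triv_left)
    next
      assume "4 * int n dvd j i - k i"
      then obtain m where "j i - k i = 4 * int n * m" by (elim dvdE)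
      then have "of_int (j i - k i) / of_int (4 * int n) = (of_int m :: real)"
        using assms by simp
      then show "of_int (j i - k i) / of_int (4 * int n) \<in> (\<int> :: real set)" by simp
    qed
    finally show ?thesis .
  qed
  then show ?thesis by (simp add: latt_eq_def latcong_def)
qed

text \<open>The bridge by which the statements about points of the alcove become statements about
  frequencies.\<close>

lemma Lam_iff:
  assumes "n \<ge> 1"
  shows "j \<in> Lam n \<longleftrightarrow> j \<in> Hlat \<and> pt n j \<in> triH"
proof -
  have n: "real n > 0" using assms by simp
  have a: "pt n j a \<le> pt n j b \<longleftrightarrow> j a \<le> j b" for a b
    using n by (simp add: pt_def divide_le_cancel)
  have "pt n j 1 - pt n j 4 = of_int (j 1 - j 4) / (4 * real n)"
    by (simp add: pt_def diff_divide_distrib)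
  then have "pt n j 1 - pt n j 4 \<le> 1 \<longleftrightarrow> of_int (j 1 - j 4) \<le> 4 * real n"
    using n by (simp add: pos_divide_le_eq)
  also have "\<dots> \<longleftrightarrow> j 1 - j 4 \<le> 4 * int n"
    by linarith
  finally have b: "pt n j 1 - pt n j 4 \<le> 1 \<longleftrightarrow> j 1 \<le> j 4 + 4 * int n" by linarith
  have "j \<in> Hlat \<and> pt n j \<in> triH \<longleftrightarrow> j \<in> Hlat \<and> pt n j 2 \<le> pt n j 1 \<and> pt n j 3 \<le> pt n j 2 \<and>
      pt n j 4 \<le> pt n j 3 \<and> pt n j 1 - pt n j 4 \<le> 1"
    using pt_RH[of j n] by (auto simp: triH_def)
  then show ?thesis unfolding a b Lam_def by auto
qed

lemma Lam_unique:
  assumes n: "n \<ge> 1" and j: "j \<in> Lam n" and k: "k \<in> Lam n" and s: "\<sigma> \<in> S4" and e: "latcong n k (j \<circ> \<sigma>)"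
  shows "j = k"
proof
  fix i
  show "j i = k i"
  proof (cases "i \<in> {1..4}")
    case True
    have "pt n j i = pt n k i"
      by (rule triH_unique[OF _ _ s _ True])
        (use j k e in \<open>simp_all add: Lam_iff[OF n] latt_eq_pt[OF n] pt_comp[symmetric]\<close>)
    then show ?thesis using n by (simp add: pt_def)
  qed (use j k in \<open>auto simp: Lam_def Hlat_iff\<close>)
qed

lemma Lam_exists:
  assumes n: "n \<ge> 1" and j: "j \<in> Hlat"
  shows "\<exists>k\<in>Lam n. \<exists>\<sigma>\<in>S4. latcong n k (j \<circ> \<sigma>)"
proof -
  obtain \<sigma> y where s: "\<sigma> \<in> S4" and y: "y \<in> triH" and e: "latt_eq y (pt n j \<circ> \<sigma>)"
    using triH_exists[OF pt_RH[OF j]] by blast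
  have "\<forall>i\<in>{1..4}. \<exists>m. y i - pt n j (\<sigma> i) = of_int m"
    using e by (auto simp: latt_eq_def elim!: Ints_cases)
  then obtain m where m: "\<And>i. i \<in> {1..4} \<Longrightarrow> y i - pt n j (\<sigma> i) = of_int (m i)"
    unfolding bchoice_iff by blast
  \<comment> \<open>The alcove point \<open>y\<close> scaled by 4n: an integer shift
    \<open>m i\<close> becomes \<open>4 * int n * m i\<close>, which is divisible by 4 and so keeps
    the residues that \<open>Hlat\<close> prescribes.\<close>
  define k where "k i = (if i \<in> {1..4} then j (\<sigma> i) + 4 * int n * m i else 0)" for i
  have ky: "pt n k i = y i" if "i \<in> {1..4}" for i
    using m[OF that] that n by (simp add: k_def pt_def field_simps)
  have jm: "(j \<circ> \<sigma>) i mod 4 = (j \<circ> \<sigma>) l mod 4" if "i \<in> {1..4}" "l \<in> {1..4}" for i l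
    using Hlat_comp[OF j s] that unfolding Hlat_iff by blast
  have "pt n k 1 + pt n k 2 + pt n k 3 + pt n k 4 = 0"
    using y ky[of 1] ky[of 2] ky[of 3] ky[of 4] by (simp add: triH_def RH_def)
  then have "of_int (k 1 + k 2 + k 3 + k 4) = (0::real)"
    using n by (simp add: pt_def add_divide_distrib[symmetric])
  then have sk: "k 1 + k 2 + k 3 + k 4 = 0" by (simp only: of_int_eq_0_iff)
  have km: "k i mod 4 = (j \<circ> \<sigma>) i mod 4" if "i \<in> {1..4}" for i
  proof -
    have "k i = (j \<circ> \<sigma>) i + 4 * (int n * m i)" using that by (simp add: k_def)
    then show ?thesis by simp
  qed
  have "\<forall>i\<in>{1..4}. \<forall>l\<in>{1..4}. k i mod 4 = k l mod 4"
  proof (intro ballI)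
    fix i l :: nat assume il: "i \<in> {1..4}" "l \<in> {1..4}"
    show "k i mod 4 = k l mod 4" unfolding km[OF il(1)] km[OF il(2)] by (rule jm[OF il])
  qed
  moreover have "\<forall>i. i \<notin> {1..4} \<longrightarrow> k i = 0" by (simp add: k_def)
  ultimately have "k \<in> Hlat" using sk unfolding Hlat_iff sum_14 by blast
  moreover have "pt n k \<in> triH"
    using y ky[of 1] ky[of 2] ky[of 3] ky[of 4] by (simp add: triH_def RH_def)
  moreover have "latcong n k (j \<circ> \<sigma>)" by (auto simp: latcong_def k_def)
  ultimately show ?thesis using s Lam_iff[OF n] by blast
qed

text \<open>The instance of \<open>card_young\<close> in which two coordinates are related when
  congruent modulo 4n. All four walls at once would force \<open>j 1 = j 4\<close> and
  \<open>j 1 = j 4 + 4 * int n\<close>, impossible for positive \<open>n\<close>.\<close>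

lemma card_stabiliser:
  assumes n: "n \<ge> 1" and j: "j \<in> Lam n"
  shows "real (card {\<sigma>\<in>S4. latcong n (j \<circ> \<sigma>) j}) * lam n j = 24"
proof -
  have o: "j 2 \<le> j 1" "j 3 \<le> j 2" "j 4 \<le> j 3" "j 1 \<le> j 4 + 4 * int n"
    using j by (auto simp: Lam_def)
  \<comment> \<open>Differences of an earlier and a later coordinate lie in this range, so a
    congruence leaves only the two extreme values, and the walls describe both.\<close>
  have dv: "4 * int n dvd z \<longleftrightarrow> z = 0 \<or> z = 4 * int n" if "0 \<le> z" "z \<le> 4 * int n" for z
    using that zdvd_imp_le[of "4 * int n" z] by (cases "z = 0") auto
  have "real (card {\<sigma>\<in>S4. \<forall>i\<in>{1..4}. 4 * int n dvd j (\<sigma> i) - j i}) *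
    (let cnt = of_bool (j 1 = j 2) + of_bool (j 2 = j 3) + of_bool (j 3 = j 4) +
        (of_bool (j 1 = j 4 + 4 * int n) :: nat) in
      if cnt = 0 then 24 else if cnt = 1 then 12
      else if cnt = 2 then (if ((j 1 = j 2) \<and> (j 3 = j 4)) \<or> ((j 2 = j 3) \<and> (j 1 = j 4 + 4 * int n)) then 6 else 4)
      else if cnt = 3 then 1 else 0) = 24"
  proof (rule card_young[where R = "\<lambda>a b. 4 * int n dvd j a - j b"])
    show "(4 * int n dvd j 1 - j 2) = (j 1 = j 2 \<or> j 2 = j 3 \<and> j 3 = j 4 \<and> j 1 = j 4 + 4 * int n)"
      using o by (subst dv) auto
    show "(4 * int n dvd j 2 - j 3) = (j 2 = j 3 \<or> j 3 = j 4 \<and> j 1 = j 4 + 4 * int n \<and> j 1 = j 2)"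
      using o by (subst dv) auto
    show "(4 * int n dvd j 3 - j 4) = (j 3 = j 4 \<or> j 1 = j 4 + 4 * int n \<and> j 1 = j 2 \<and> j 2 = j 3)"
      using o by (subst dv) auto
    show "(4 * int n dvd j 1 - j 4) = (j 1 = j 4 + 4 * int n \<or> j 1 = j 2 \<and> j 2 = j 3 \<and> j 3 = j 4)"
      using o by (subst dv) auto
    show "(4 * int n dvd j 1 - j 3) = (j 1 = j 2 \<and> j 2 = j 3 \<or> j 3 = j 4 \<and> j 1 = j 4 + 4 * int n)"
      using o by (subst dv) auto
    show "(4 * int n dvd j 2 - j 4) = (j 2 = j 3 \<and> j 3 = j 4 \<or> j 1 = j 4 + 4 * int n \<and> j 1 = j 2)"
      using o by (subst dv) auto
  qed (use n in \<open>auto simp: dvd_diff_commute\<close>)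
  then show ?thesis unfolding lam_def latcong_def Let_def o_def .
qed

text \<open>The permutations on the left form the right coset of the stabiliser of the class of
  \<open>j\<close> through \<sigma>; composing with \<open>inv \<sigma>\<close> maps it bijectively
  to the stabiliser.\<close>

lemma card_coset:
  assumes "\<sigma> \<in> S4" "latcong n y (j \<circ> \<sigma>)"
  shows "card {\<tau>\<in>S4. latcong n y (j \<circ> \<tau>)} = card {\<tau>\<in>S4. latcong n (j \<circ> \<tau>) j}"
proof (rule bij_betw_same_card, rule bij_betw_byWitness[where f = "\<lambda>\<tau>. \<tau> \<circ> inv \<sigma>" and f' = "\<lambda>\<tau>. \<tau> \<circ> \<sigma>"])
  have "latcong n y (j \<circ> \<tau>) \<longleftrightarrow> latcong n (j \<circ> \<tau>) (j \<circ> \<sigma>)" for \<tau>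
  proof
    assume h: "latcong n y (j \<circ> \<tau>)"
    show "latcong n (j \<circ> \<tau>) (j \<circ> \<sigma>)" by (rule latcong_trans[OF latcong_sym[OF h] assms(2)])
  next
    assume h: "latcong n (j \<circ> \<tau>) (j \<circ> \<sigma>)"
    show "latcong n y (j \<circ> \<tau>)" by (rule latcong_trans[OF assms(2) latcong_sym[OF h]])
  qed
  also have "\<And>\<tau>. latcong n (j \<circ> \<tau>) (j \<circ> \<sigma>) \<longleftrightarrow> latcong n (j \<circ> (\<tau> \<circ> inv \<sigma>)) j"
    using latcong_comp_iff[OF S4_inv[OF assms(1)], of n "j \<circ> \<tau>" "j \<circ> \<sigma>" for \<tau>] assms(1)
    by (simp add: comp_assoc)
  finally have *: "latcong n y (j \<circ> \<tau>) \<longleftrightarrow> latcong n (j \<circ> (\<tau> \<circ> inv \<sigma>)) j" for \<tau> .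
  show "(\<lambda>\<tau>. \<tau> \<circ> inv \<sigma>) ` {\<tau> \<in> S4. latcong n y (j \<circ> \<tau>)} \<subseteq> {\<tau> \<in> S4. latcong n (j \<circ> \<tau>) j}"
    using assms(1) by (auto simp: * S4_comp S4_inv)
  show "(\<lambda>\<tau>. \<tau> \<circ> \<sigma>) ` {\<tau> \<in> S4. latcong n (j \<circ> \<tau>) j} \<subseteq> {\<tau> \<in> S4. latcong n y (j \<circ> \<tau>)}"
    using assms(1) by (auto simp: * S4_comp comp_assoc)
qed (use assms(1) in \<open>auto simp: comp_assoc\<close>)

section \<open>The finite quotient group and unfolding of weighted sums\<close>

text \<open>A system of representatives of \<open>Hlat\<close> modulo \<open>latcong n\<close>; the
  fourth coordinate follows from the zero sum.\<close>

definition Qlat :: "nat \<Rightarrow> (nat \<Rightarrow> int) set" where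
  "Qlat n = {j \<in> Hlat. \<forall>i\<in>{1,2,3}. 0 \<le> j i \<and> j i < 4 * int n}"

text \<open>Three coordinates are reduced modulo 4n; the zero sum then makes the fourth one
  congruent as well. The reduction stays in \<open>Hlat\<close> because 4 divides 4n.\<close>

lemma Qlat_ex1:
  assumes n: "n \<ge> 1" and v: "v \<in> Hlat"
  shows "\<exists>!j. j \<in> Qlat n \<and> latcong n j v"
proof (rule ex_ex1I)
  define N where "N = 4 * int n"
  have N: "N > 0" "4 dvd N" using n by (auto simp: N_def)
  define j where "j i = (if i \<in> {1,2,3} then v i mod N else if i = 4 then
      - (v 1 mod N + v 2 mod N + v 3 mod N) else 0)" for i :: nat
  have sv: "v 4 = - (v 1 + v 2 + v 3)" using v by (simp add: Hlat_def)
  have d: "N dvd v i mod N - v i" for i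
    by (metis mod_eq_dvd_iff mod_mod_trivial)
  have "N dvd (v 1 mod N - v 1) + (v 2 mod N - v 2) + (v 3 mod N - v 3)"
    by (intro dvd_add d)
  then have "N dvd - ((v 1 mod N - v 1) + (v 2 mod N - v 2) + (v 3 mod N - v 3))"
    by (simp only: dvd_minus_iff)
  then have "N dvd j 4 - v 4" by (simp add: j_def sv algebra_simps)
  then have c: "latcong n j v" unfolding latcong_def N_def[symmetric] ball_14 using d by (simp add: j_def)
  have jm: "j i mod 4 = v i mod 4" if "i \<in> {1..4}" for i
    using c N(2) that unfolding latcong_def N_def[symmetric] mod_eq_dvd_iff using dvd_trans by blast
  have js: "j 1 + j 2 + j 3 + j 4 = 0" by (simp add: j_def)
  have jo: "\<forall>i. i \<notin> {1..4} \<longrightarrow> j i = 0" by (simp add: j_def)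
  have "v 1 mod 4 = v 2 mod 4 \<and> v 2 mod 4 = v 3 mod 4 \<and> v 3 mod 4 = v 4 mod 4"
    using v by (simp add: Hlat_def)
  then have "j 1 mod 4 = j 2 mod 4 \<and> j 2 mod 4 = j 3 mod 4 \<and> j 3 mod 4 = j 4 mod 4"
    by (simp add: jm del: One_nat_def)
  then have "j \<in> Hlat"
    unfolding Hlat_def using js jo by blast
  moreover have "\<forall>i\<in>{1,2,3}. 0 \<le> j i \<and> j i < N"
    using N by (auto simp: j_def)
  ultimately show "\<exists>j. j \<in> Qlat n \<and> latcong n j v" using c by (auto simp: Qlat_def N_def)
next
  fix j k assume j: "j \<in> Qlat n \<and> latcong n j v" and k: "k \<in> Qlat n \<and> latcong n k v"
  then have "latcong n j k" using latcong_trans[OF _ latcong_sym] by blast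
  then have e: "j i = k i" if "i \<in> {1,2,3}" for i
  proof -
    have "4 * int n dvd j i - k i" using \<open>latcong n j k\<close> that by (auto simp: latcong_def)
    then have "j i mod (4 * int n) = k i mod (4 * int n)" by (simp add: mod_eq_dvd_iff)
    moreover have "0 \<le> j i \<and> j i < 4 * int n" "0 \<le> k i \<and> k i < 4 * int n"
      using j k that unfolding Qlat_def by blast+
    ultimately show ?thesis by simp
  qed
  have "j 1 + j 2 + j 3 + j 4 = 0" "k 1 + k 2 + k 3 + k 4 = 0"
    using j k by (auto simp: Qlat_def Hlat_def)
  then have e4: "j 4 = k 4" using e[of 1] e[of 2] e[of 3] by simp
  show "j = k"
  proof
    fix i :: nat
    consider "i \<in> {1,2,3}" | "i = 4" | "i \<notin> {1..4}" by force
    then show "j i = k i" using e e4 j k by cases (auto simp: Qlat_def Hlat_iff)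
  qed
qed

definition quad :: "int \<Rightarrow> int \<Rightarrow> int \<Rightarrow> nat \<Rightarrow> int" where
  "quad a b c = (\<lambda>i. if i = 1 then a else if i = 2 then b else if i = 3 then c
    else if i = 4 then - (a + b + c) else 0)"

lemma quad_Hlat: "k \<in> Hlat \<Longrightarrow> quad (k 1) (k 2) (k 3) = k"
  by (rule ext) (auto simp: quad_def Hlat_iff sum_14 simp del: One_nat_def)

lemma finite_Lam: "finite (Lam m)"
proof (rule finite_subset)
  show "Lam m \<subseteq> (\<lambda>(a,b,c). quad a b c) ` ({-4*int m..4*int m} \<times> {-4*int m..4*int m} \<times> {-4*int m..4*int m})"
  proof
    fix k assume k: "k \<in> Lam m"
    then have "k = (\<lambda>(a,b,c). quad a b c) (k 1, k 2, k 3)"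
      using quad_Hlat by (simp add: Lam_def)
    moreover have "k 1 + k 2 + k 3 + k 4 = 0" "k 4 \<le> k 3" "k 3 \<le> k 2" "k 2 \<le> k 1" "k 1 \<le> k 4 + 4 * int m"
      using k by (auto simp: Lam_def Hlat_def)
    then have "(k 1, k 2, k 3) \<in> {-4*int m..4*int m} \<times> {-4*int m..4*int m} \<times> {-4*int m..4*int m}"
      by auto
    ultimately show "k \<in> (\<lambda>(a,b,c). quad a b c) ` ({-4*int m..4*int m} \<times> {-4*int m..4*int m} \<times> {-4*int m..4*int m})"
      by (rule image_eqI)
  qed
qed auto

lemma finite_Qlat: "finite (Qlat n)"
proof (rule finite_subset)
  show "Qlat n \<subseteq> (\<lambda>(a,b,c). quad a b c) ` ({0..4*int n} \<times> {0..4*int n} \<times> {0..4*int n})"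
  proof
    fix k assume k: "k \<in> Qlat n"
    then have "k = (\<lambda>(a,b,c). quad a b c) (k 1, k 2, k 3)"
      using quad_Hlat by (simp add: Qlat_def)
    moreover have "(k 1, k 2, k 3) \<in> {0..4*int n} \<times> {0..4*int n} \<times> {0..4*int n}"
      using k by (auto simp: Qlat_def)
    ultimately show "k \<in> (\<lambda>(a,b,c). quad a b c) ` ({0..4*int n} \<times> {0..4*int n} \<times> {0..4*int n})"
      by (rule image_eqI)
  qed
qed auto

text \<open>Each class of \<open>Qlat\<close> meets \<open>Lam n\<close> in one \<open>S4\<close>-orbit of size \<open>lam\<close>, by orbit--stabiliser.\<close>
lemma sum_Lam_eq_sum_Qlat:
  fixes F :: "(nat \<Rightarrow> int) \<Rightarrow> complex"
  assumes n: "n \<ge> 1"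
    and per: "\<And>j k. j \<in> Hlat \<Longrightarrow> k \<in> Hlat \<Longrightarrow> latcong n j k \<Longrightarrow> F j = F k"
    and sym: "\<And>j \<sigma>. j \<in> Hlat \<Longrightarrow> \<sigma> \<in> S4 \<Longrightarrow> F (j \<circ> \<sigma>) = F j"
  shows "(\<Sum>j\<in>Lam n. complex_of_real (lam n j) * F j) = (\<Sum>j\<in>Qlat n. F j)"
proof -
  have LH: "j \<in> Hlat" if "j \<in> Lam n" for j using that by (simp add: Lam_def)
  have QH: "j \<in> Hlat" if "j \<in> Qlat n" for j using that by (simp add: Qlat_def)
  \<comment> \<open>Exactly one representative is congruent to \<open>l \<circ> \<sigma>\<close>,
    and by both invariances \<open>F\<close> has the value \<open>F l\<close> there.\<close>
  have a: "F l = (\<Sum>j\<in>Qlat n. if latcong n j (l \<circ> \<sigma>) then F j else 0)" if l: "l \<in> Lam n" and s: "\<sigma> \<in> S4" for l \<sigma>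
  proof -
    obtain q where q: "q \<in> Qlat n" "latcong n q (l \<circ> \<sigma>)"
      and uq: "\<forall>j. j \<in> Qlat n \<and> latcong n j (l \<circ> \<sigma>) \<longrightarrow> j = q"
      using Qlat_ex1[OF n Hlat_comp[OF LH[OF l] s]] unfolding Ex1_def by blast
    have "(\<Sum>j\<in>Qlat n. if latcong n j (l \<circ> \<sigma>) then F j else 0) = (\<Sum>j\<in>Qlat n. if j = q then F j else 0)"
    proof (rule sum.cong[OF refl])
      fix j assume "j \<in> Qlat n"
      then have "latcong n j (l \<circ> \<sigma>) \<longleftrightarrow> j = q" using uq q(2) by blast
      then show "(if latcong n j (l \<circ> \<sigma>) then F j else 0) = (if j = q then F j else 0)" by simp
    qed
    also have "\<dots> = F q" using q(1) finite_Qlat by simp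
    also have "\<dots> = F (l \<circ> \<sigma>)" by (rule per[OF QH[OF q(1)] Hlat_comp[OF LH[OF l] s] q(2)])
    finally show ?thesis using sym[OF LH[OF l] s] by simp
  qed
  \<comment> \<open>Only one \<open>l\<close> contributes, by \<open>Lam_unique\<close>; its
    permutations form a coset of the stabiliser, whose order times the weight is 24.\<close>
  have b: "(\<Sum>l\<in>Lam n. \<Sum>\<sigma>\<in>S4. if latcong n j (l \<circ> \<sigma>) then lam n l else 0) = 24" if j: "j \<in> Qlat n" for j
  proof -
    obtain l \<sigma> where l: "l \<in> Lam n" and s: "\<sigma> \<in> S4" and e: "latcong n l (j \<circ> \<sigma>)"
      using Lam_exists[OF n QH[OF j]] by blast
    have e': "latcong n j (l \<circ> inv \<sigma>)"
      using latcong_sym[OF latcong_comp[OF e S4_inv[OF s]]] s by (simp add: comp_assoc)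
    have "l' = l" if l': "l' \<in> Lam n" and t: "\<tau> \<in> S4" and c: "latcong n j (l' \<circ> \<tau>)" for l' \<tau>
    proof -
      have "latcong n (l' \<circ> \<tau>) (l \<circ> inv \<sigma>)" by (rule latcong_trans[OF latcong_sym[OF c] e'])
      from latcong_comp[OF this S4_inv[OF t]] have "latcong n l' (l \<circ> (inv \<sigma> \<circ> inv \<tau>))"
        using t by (simp add: comp_assoc)
      then show ?thesis using Lam_unique[OF n l l' S4_comp[OF S4_inv[OF s] S4_inv[OF t]]] by blast
    qed
    then have z: "(\<Sum>\<sigma>\<in>S4. if latcong n j (l' \<circ> \<sigma>) then lam n l' else 0) =
       (if l' = l then (\<Sum>\<sigma>\<in>S4. if latcong n j (l \<circ> \<sigma>) then lam n l else 0) else 0)"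
      if "l' \<in> Lam n" for l'
      using that by (auto intro!: sum.neutral)
    have "(\<Sum>l\<in>Lam n. \<Sum>\<sigma>\<in>S4. if latcong n j (l \<circ> \<sigma>) then lam n l else 0) =
        (\<Sum>l'\<in>Lam n. if l' = l then (\<Sum>\<sigma>\<in>S4. if latcong n j (l \<circ> \<sigma>) then lam n l else 0) else 0)"
      by (rule sum.cong[OF refl z])
    also have "\<dots> = (\<Sum>\<sigma>\<in>S4. if latcong n j (l \<circ> \<sigma>) then lam n l else 0)"
      using l finite_Lam[of n] by simp
    also have "\<dots> = real (card {\<sigma>\<in>S4. latcong n j (l \<circ> \<sigma>)}) * lam n l"
      using finite_S4 by (simp add: sum.If_cases Int_def)
    also have "\<dots> = 24"
      unfolding card_coset[OF S4_inv[OF s] e'] by (rule card_stabiliser[OF n l])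
    finally show ?thesis .
  qed
  \<comment> \<open>Double counting of the triples \<open>l\<close>, \<sigma>, \<open>j\<close> with
    \<open>j\<close> congruent to \<open>l \<circ> \<sigma>\<close>: summing over \<open>j\<close>
    first is \<open>a\<close>, summing over \<open>l\<close> and \<sigma> first is
    \<open>b\<close>.\<close>
  have "24 * (\<Sum>l\<in>Lam n. complex_of_real (lam n l) * F l) =
     (\<Sum>l\<in>Lam n. \<Sum>\<sigma>\<in>S4. complex_of_real (lam n l) * F l)"
    by (simp add: card_S4 sum_distrib_left)
  also have "\<dots> = (\<Sum>l\<in>Lam n. \<Sum>\<sigma>\<in>S4. \<Sum>j\<in>Qlat n. if latcong n j (l \<circ> \<sigma>) then complex_of_real (lam n l) * F j else 0)"
  proof (intro sum.cong refl)
    fix l \<sigma> assume "l \<in> Lam n" "\<sigma> \<in> S4"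
    from a[OF this] have "complex_of_real (lam n l) * F l = complex_of_real (lam n l) *
        (\<Sum>j\<in>Qlat n. if latcong n j (l \<circ> \<sigma>) then F j else 0)" by (rule arg_cong)
    then show "complex_of_real (lam n l) * F l =
        (\<Sum>j\<in>Qlat n. if latcong n j (l \<circ> \<sigma>) then complex_of_real (lam n l) * F j else 0)"
      unfolding sum_distrib_left by (simp only: if_distrib mult_zero_right cong: if_cong)
  qed
  also have "\<dots> = (\<Sum>l\<in>Lam n. \<Sum>j\<in>Qlat n. \<Sum>\<sigma>\<in>S4. if latcong n j (l \<circ> \<sigma>) then complex_of_real (lam n l) * F j else 0)"
    by (intro sum.cong refl sum.swap)
  also have "\<dots> = (\<Sum>j\<in>Qlat n. \<Sum>l\<in>Lam n. \<Sum>\<sigma>\<in>S4. if latcong n j (l \<circ> \<sigma>) then complex_of_real (lam n l) * F j else 0)"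
    by (rule sum.swap)
  also have "\<dots> = (\<Sum>j\<in>Qlat n. complex_of_real (\<Sum>l\<in>Lam n. \<Sum>\<sigma>\<in>S4. if latcong n j (l \<circ> \<sigma>) then lam n l else 0) * F j)"
    unfolding of_real_sum sum_distrib_right by (intro sum.cong refl) auto
  also have "\<dots> = 24 * (\<Sum>j\<in>Qlat n. F j)"
    by (simp add: b sum_distrib_left)
  finally show ?thesis by simp
qed

subsection \<open>Discrete orthogonality\<close>

lemma sum_roots_of_unity:
  assumes n: "n \<ge> 1"
  shows "(\<Sum>a<n. cis (2 * pi * of_int m * real a / real n)) = (if int n dvd m then of_nat n else 0)"
proof -
  define z where "z = cis (2 * pi * of_int m / real n)"
  have p: "cis (2 * pi * of_int m * real a / real n) = z ^ a" for a
    unfolding z_def Complex.DeMoivre by (rule arg_cong[where f = cis]) simp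
  have zn: "z ^ n = 1"
    using n cis_multiple_2pi[of "of_int m"] by (simp add: z_def Complex.DeMoivre)
  have z1: "z = 1 \<longleftrightarrow> int n dvd m"
  proof
    assume "z = 1"
    then have "cos (2 * pi * of_int m / real n) = 1"
      unfolding z_def by (simp add: complex_eq_iff)
    then obtain k :: int where "2 * pi * of_int m / real n = of_int k * 2 * pi"
      unfolding cos_one_2pi_int by blast
    then have "of_int m = (of_int (int n * k) :: real)" using n by (simp add: field_simps)
    then show "int n dvd m" by (simp only: of_int_eq_iff dvd_triv_left)
  next
    assume "int n dvd m"
    then obtain k where "m = int n * k" by (elim dvdE)
    then show "z = 1" using n cis_multiple_2pi[of "of_int k"] by (simp add: z_def mult.assoc)
  qed
  show ?thesis
  proof (cases "z = 1")
    case True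
    then show ?thesis using z1 by (simp add: p)
  next
    case False
    then show ?thesis using z1 zn unfolding p by (simp add: geometric_sum)
  qed
qed

text \<open>Here \<open>r\<close> is the common residue modulo 4 and \<open>a\<close>,
  \<open>b\<close>, \<open>c\<close> are the quotients of the first three coordinates. With
  \<open>r < 4\<close> and quotients below \<open>n\<close> this gives the \<open>4 * n ^ 3\<close>
  elements of \<open>Qlat n\<close>.\<close>

definition Qpt :: "nat \<Rightarrow> nat \<Rightarrow> nat \<Rightarrow> nat \<Rightarrow> nat \<Rightarrow> int" where
  "Qpt r a b c = quad (4 * int a + int r) (4 * int b + int r) (4 * int c + int r)"

lemma bij_Qpt:
  assumes n: "n \<ge> 1"
  shows "bij_betw (\<lambda>(r,a,b,c). Qpt r a b c) ({..<4} \<times> {..<n} \<times> {..<n} \<times> {..<n}) (Qlat n)"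
proof (rule bij_betw_byWitness[where f' = "\<lambda>j. (nat (j 1 mod 4), nat (j 1 div 4), nat (j 2 div 4), nat (j 3 div 4))"])
  show "(\<lambda>(r,a,b,c). Qpt r a b c) ` ({..<4} \<times> {..<n} \<times> {..<n} \<times> {..<n}) \<subseteq> Qlat n"
  proof clarify
    fix r a b c assume h: "r < (4::nat)" "a < n" "b < n" "c < n"
    define q where "q = Qpt r a b c"
    have q: "q 1 = 4 * int a + int r" "q 2 = 4 * int b + int r" "q 3 = 4 * int c + int r"
      "q 4 = - (q 1 + q 2 + q 3)" "\<forall>i. i \<notin> {1..4} \<longrightarrow> q i = 0"
      by (auto simp: q_def Qpt_def quad_def)
    \<comment> \<open>The fourth coordinate has residue -3r, which is r modulo 4.\<close>
    have "q 3 mod 4 = q 4 mod 4"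
    proof -
      have "q 3 - q 4 = 4 * (int a + int b + 2 * int c + int r)"
        unfolding q(4) q(1-3) by (simp add: algebra_simps)
      then show ?thesis unfolding mod_eq_dvd_iff by simp
    qed
    moreover have "q 1 mod 4 = q 2 mod 4" "q 2 mod 4 = q 3 mod 4"
      unfolding q(1-3) by simp_all
    moreover have "q 1 + q 2 + q 3 + q 4 = 0" unfolding q(4) by simp
    ultimately have "q \<in> Hlat" unfolding Hlat_def using q(5) by blast
    moreover have "\<forall>i\<in>{1,2,3}. 0 \<le> q i \<and> q i < 4 * int n"
      using h q(1-3) by simp
    ultimately show "Qpt r a b c \<in> Qlat n" unfolding q_def[symmetric] Qlat_def by blast
  qed
  show "(\<lambda>j. (nat (j 1 mod 4), nat (j 1 div 4), nat (j 2 div 4), nat (j 3 div 4))) ` Qlat n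
      \<subseteq> {..<4} \<times> {..<n} \<times> {..<n} \<times> {..<n}"
  proof (rule image_subsetI)
    fix j assume "j \<in> Qlat n"
    then have "0 \<le> j 1" "j 1 < 4 * int n" "0 \<le> j 2" "j 2 < 4 * int n" "0 \<le> j 3" "j 3 < 4 * int n"
      by (auto simp: Qlat_def)
    then show "(nat (j 1 mod 4), nat (j 1 div 4), nat (j 2 div 4), nat (j 3 div 4)) \<in>
        {..<4} \<times> {..<n} \<times> {..<n} \<times> {..<n}"
      using pos_mod_bound[of 4 "j 1"] by (auto simp: nat_less_iff)
  qed
  show "\<forall>p\<in>{..<4} \<times> {..<n} \<times> {..<n} \<times> {..<n}.
     (\<lambda>j. (nat (j 1 mod 4), nat (j 1 div 4), nat (j 2 div 4), nat (j 3 div 4)))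
       ((\<lambda>(r,a,b,c). Qpt r a b c) p) = p"
    by (auto simp: Qpt_def quad_def)
  show "\<forall>j\<in>Qlat n. (\<lambda>(r,a,b,c). Qpt r a b c) (nat (j 1 mod 4), nat (j 1 div 4), nat (j 2 div 4), nat (j 3 div 4)) = j"
  proof
    fix j assume j: "j \<in> Qlat n"
    then have h: "0 \<le> j 1" "0 \<le> j 2" "0 \<le> j 3" "j 1 mod 4 = j 2 mod 4" "j 2 mod 4 = j 3 mod 4"
      by (auto simp: Qlat_def Hlat_def)
    have d: "4 * (j i div 4) + j i mod 4 = j i" for i by (rule mult_div_mod_eq)
    have nn: "0 \<le> j 1 div 4" "0 \<le> j 2 div 4" "0 \<le> j 3 div 4" "0 \<le> j i mod 4" for i
      using h by (simp_all add: pos_imp_zdiv_nonneg_iff)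
    have e: "4 * int (nat (j 1 div 4)) + int (nat (j 1 mod 4)) = j 1"
      "4 * int (nat (j 2 div 4)) + int (nat (j 1 mod 4)) = j 2"
      "4 * int (nat (j 3 div 4)) + int (nat (j 1 mod 4)) = j 3"
      by (simp only: nat_0_le nn d)
        (simp only: h(4) nat_0_le nn d, simp only: h(4,5) nat_0_le nn d)
    show "(\<lambda>(r,a,b,c). Qpt r a b c) (nat (j 1 mod 4), nat (j 1 div 4), nat (j 2 div 4), nat (j 3 div 4)) = j"
      unfolding prod.case Qpt_def e using j quad_Hlat[of j] unfolding Qlat_def by blast
  qed
qed

text \<open>The sum factors into three sums of n-th roots of unity and one over the residue
  \<open>r\<close>. The former vanish unless \<open>n\<close> divides \<open>m1\<close>,
  \<open>m2\<close>, \<open>m3\<close>; the latter then decides whether 4n divides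
  \<open>m1 + m2 + m3\<close>, which is minus \<open>k 4\<close>.\<close>

lemma sum_Qlat_phi:
  assumes n: "n \<ge> 1" and k: "k \<in> Hlat"
  shows "(\<Sum>j\<in>Qlat n. phi k (pt n j)) = (if latcong n k (\<lambda>_. 0) then of_nat (4 * n ^ 3) else 0)"
proof -
  have k0: "k 1 + k 2 + k 3 + k 4 = 0" using k by (simp add: Hlat_def)
  have "4 dvd k 1 - k 4" "4 dvd k 2 - k 4" "4 dvd k 3 - k 4"
    using k by (auto simp: Hlat_def mod_eq_dvd_iff[symmetric])
  then obtain m1 m2 m3 where m: "k 1 = k 4 + 4 * m1" "k 2 = k 4 + 4 * m2" "k 3 = k 4 + 4 * m3"
    by (metis dvdE diff_add_cancel add.commute)
  have k4: "k 4 = - (m1 + m2 + m3)" using k0 m by linarith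
  define e where "e N q a = cis (2 * pi * of_int q * real a / real N)" for N q a
  have ph: "phi k (pt n (Qpt r a b c)) = e (4 * n) (m1 + m2 + m3) r * (e n m1 a * (e n m2 b * e n m3 c))"
    for r a b c
  proof -
    \<comment> \<open>The fourth coordinate of the node is minus the sum of the others, so only the
      differences \<open>k i - k 4\<close>, four times \<open>m1\<close>, \<open>m2\<close>,
      \<open>m3\<close>, enter.\<close>
    have "(\<Sum>i\<in>{1..4}. real_of_int (k i) * pt n (Qpt r a b c) i) =
       4 * (of_int (m1 + m2 + m3) * real r / real (4 * n) + (of_int m1 * real a / real n +
         (of_int m2 * real b / real n + of_int m3 * real c / real n)))"
      unfolding sum_14 m(1) m(2) m(3) using n
      by (simp add: pt_def Qpt_def quad_def field_simps)
    then show ?thesis unfolding phi_cis e_def cis_mult by (simp add: algebra_simps)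
  qed
  have "(\<Sum>j\<in>Qlat n. phi k (pt n j)) =
      (\<Sum>(r,a,b,c)\<in>{..<4} \<times> {..<n} \<times> {..<n} \<times> {..<n}. phi k (pt n (Qpt r a b c)))"
    using sum.reindex_bij_betw[OF bij_Qpt[OF n], of "\<lambda>j. phi k (pt n j)"]
    by (simp add: case_prod_unfold)
  also have "\<dots> = (\<Sum>r<4. \<Sum>a<n. \<Sum>b<n. \<Sum>c<n. phi k (pt n (Qpt r a b c)))"
    by (simp add: sum.cartesian_product)
  also have "\<dots> = (\<Sum>r<4. e (4 * n) (m1 + m2 + m3) r) * ((\<Sum>a<n. e n m1 a) * ((\<Sum>b<n. e n m2 b) * (\<Sum>c<n. e n m3 c)))"
    unfolding ph sum_distrib_left[symmetric] sum_distrib_right[symmetric] ..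
  finally have S: "(\<Sum>j\<in>Qlat n. phi k (pt n j)) = \<dots>" .
  have dv: "(\<Sum>a<n. e n q a) = (if int n dvd q then of_nat n else 0)" for q
    unfolding e_def by (rule sum_roots_of_unity[OF n])
  have latcong_k: "latcong n k (\<lambda>_. 0) \<longleftrightarrow> int n dvd m1 \<and> int n dvd m2 \<and> int n dvd m3 \<and> 4 * int n dvd m1 + m2 + m3"
  proof
    assume "latcong n k (\<lambda>_. 0)"
    then have d: "4 * int n dvd k 1" "4 * int n dvd k 2" "4 * int n dvd k 3" "4 * int n dvd k 4"
      by (auto simp: latcong_def)
    have "4 * int n dvd 4 * m1" "4 * int n dvd 4 * m2" "4 * int n dvd 4 * m3"
      using dvd_diff[OF d(1,4)] dvd_diff[OF d(2,4)] dvd_diff[OF d(3,4)] m by auto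
    moreover have "4 * int n dvd m1 + m2 + m3" using d(4) unfolding k4 by (simp only: dvd_minus_iff)
    ultimately show "int n dvd m1 \<and> int n dvd m2 \<and> int n dvd m3 \<and> 4 * int n dvd m1 + m2 + m3"
      by simp
  next
    assume h: "int n dvd m1 \<and> int n dvd m2 \<and> int n dvd m3 \<and> 4 * int n dvd m1 + m2 + m3"
    then have d4: "4 * int n dvd k 4" unfolding k4 by (simp only: dvd_minus_iff)
    have "4 * int n dvd k 1" "4 * int n dvd k 2" "4 * int n dvd k 3"
      unfolding m using h by (auto intro!: dvd_add d4)
    then show "latcong n k (\<lambda>_. 0)" unfolding latcong_def ball_14 using d4 by simp
  qed
  show ?thesis
  proof (cases "int n dvd m1 \<and> int n dvd m2 \<and> int n dvd m3")
    case False
    then show ?thesis unfolding S latcong_k dv by auto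
  next
    case True
    then obtain q1 q2 q3 where q: "m1 = int n * q1" "m2 = int n * q2" "m3 = int n * q3"
      by (elim conjE dvdE)
    define Q where "Q = q1 + q2 + q3"
    have mq: "m1 + m2 + m3 = int n * Q" by (simp add: q Q_def algebra_simps)
    \<comment> \<open>Four terms with 4n-th roots of unity are in general no full period;
      divisibility by \<open>n\<close> reduces them to fourth roots.\<close>
    have "(\<Sum>r<4. e (4 * n) (m1 + m2 + m3) r) = (\<Sum>r<4. cis (2 * pi * of_int Q * real r / real 4))"
      unfolding e_def mq using n by (intro sum.cong refl) simp
    also have "\<dots> = (if 4 dvd Q then 4 else 0)"
      using sum_roots_of_unity[of 4 Q] by simp
    also have "4 dvd Q \<longleftrightarrow> 4 * int n dvd m1 + m2 + m3"
      unfolding mq using n by (simp add: mult.commute[of 4])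
    finally show ?thesis using True unfolding S latcong_k dv by (simp add: power3_eq_cube)
  qed
qed

text \<open>After unfolding, the 24 permuted frequencies contribute equally, since the class of 0 is
  invariant under permutations.\<close>

lemma cub_TC:
  assumes n: "n \<ge> 1" and k: "k \<in> Hlat"
  shows "cub n (TC k) = (if latcong n k (\<lambda>_. 0) then 1 else 0)"
proof -
  have "(\<Sum>j\<in>Lam n. complex_of_real (lam n j) * TC k (pt n j)) = (\<Sum>j\<in>Qlat n. TC k (pt n j))"
    by (rule sum_Lam_eq_sum_Qlat[OF n])
      (simp_all add: pt_comp TC_comp TC_periodic[OF k] pt_RH latt_eq_pt[OF n])
  also have "\<dots> = (1/24) * (\<Sum>\<sigma>\<in>S4. \<Sum>j\<in>Qlat n. phi (k \<circ> \<sigma>) (pt n j))"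
    unfolding TC_alt sum_distrib_left[symmetric] by (subst sum.swap) (rule refl)
  also have "\<dots> = (1/24) * (\<Sum>\<sigma>\<in>S4. if latcong n k (\<lambda>_. 0) then of_nat (4 * n ^ 3) else 0)"
  proof (intro arg_cong2[where f = "(*)"] refl sum.cong)
    fix \<sigma> assume s: "\<sigma> \<in> S4"
    have "(\<lambda>_. 0::int) = (\<lambda>_. 0) \<circ> \<sigma>" by (simp add: fun_eq_iff)
    then have "latcong n (k \<circ> \<sigma>) (\<lambda>_. 0) \<longleftrightarrow> latcong n k (\<lambda>_. 0)" using latcong_comp_iff[OF s] by metis
    then show "(\<Sum>j\<in>Qlat n. phi (k \<circ> \<sigma>) (pt n j)) = (if latcong n k (\<lambda>_. 0) then of_nat (4 * n ^ 3) else 0)"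
      using sum_Qlat_phi[OF n Hlat_comp[OF k s]] by simp
  qed
  finally show ?thesis unfolding cub_def using n by (simp add: card_S4)
qed

lemma cnj_phi: "cnj (phi k t) = cis (- (pi / 2 * (\<Sum>i\<in>{1..4}. real_of_int (k i) * t i)))"
  by (simp add: phi_cis cis_cnj)

lemma phi_mult_cnj: "phi k t * cnj (phi l t) = phi (\<lambda>i. k i - l i) t"
  unfolding cnj_phi unfolding phi_cis cis_mult
  by (simp add: sum_subtractf algebra_simps)

lemma Hlat_diff:
  assumes "k \<in> Hlat" "l \<in> Hlat"
  shows "(\<lambda>i. k i - l i) \<in> Hlat"
  unfolding Hlat_iff
proof (intro conjI allI impI ballI)
  fix i :: nat assume "i \<notin> {1..4}"
  then have "k i = 0" "l i = 0" using assms unfolding Hlat_iff by blast+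
  then show "k i - l i = 0" by simp
next
  show "(\<Sum>i\<in>{1..4}. k i - l i) = 0"
    using assms unfolding Hlat_iff sum_subtractf by simp
next
  fix i h :: nat assume "i \<in> {1..4}" "h \<in> {1..4}"
  then have "k i mod 4 = k h mod 4" "l i mod 4 = l h mod 4" using assms unfolding Hlat_iff by blast+
  then show "(k i - l i) mod 4 = (k h - l h) mod 4" by (rule mod_diff_cong)
qed

text \<open>The product expands into 576 exponentials, and a pair \<sigma>, \<tau> survives exactly
  when \<open>k \<circ> \<sigma>\<close> and \<open>l \<circ> \<tau>\<close> are congruent. For
  distinct \<open>k\<close>, \<open>l\<close> this never happens; for equal ones each of the 24
  choices of \<sigma> leaves \<open>24 / lam n k\<close> choices of \<tau>.\<close>

lemma ip_disc_TC:
  assumes n: "n \<ge> 1" and k: "k \<in> Lam n" and l: "l \<in> Lam n"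
  shows "ip_disc n (TC k) (TC l) = (if k = l then 1 / complex_of_real (lam n k) else 0)"
proof -
  have kH: "k \<in> Hlat" and lH: "l \<in> Hlat" using k l by (auto simp: Lam_def)
  have c: "latcong n (\<lambda>i. k i - l i) (\<lambda>_. 0) \<longleftrightarrow> latcong n k l" for k l by (simp add: latcong_def)
  have cn: "real (card {\<tau>\<in>S4. latcong n (k \<circ> \<sigma>) (l \<circ> \<tau>)}) * lam n k = (if k = l then 24 else 0)"
    if s: "\<sigma> \<in> S4" for \<sigma>
  proof (cases "k = l")
    case True
    show ?thesis using card_coset[OF s latcong_refl, of n k] card_stabiliser[OF n k] True by simp
  next
    case False
    have "\<not> latcong n (k \<circ> \<sigma>) (l \<circ> \<tau>)" if t: "\<tau> \<in> S4" for \<tau>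
    proof
      assume "latcong n (k \<circ> \<sigma>) (l \<circ> \<tau>)"
      from latcong_comp[OF this S4_inv[OF s]] have "latcong n k (l \<circ> (\<tau> \<circ> inv \<sigma>))"
        using s by (simp add: comp_assoc)
      then show False using Lam_unique[OF n l k S4_comp[OF t S4_inv[OF s]]] False by simp
    qed
    then have e: "{\<tau>\<in>S4. latcong n (k \<circ> \<sigma>) (l \<circ> \<tau>)} = {}" by blast
    show ?thesis unfolding e using False by simp
  qed
  have lam0: "lam n k \<noteq> 0" using card_stabiliser[OF n k] by auto
  have per: "TC h (pt n a) = TC h (pt n b)" if "h \<in> Hlat" "a \<in> Hlat" "b \<in> Hlat" "latcong n a b" for h a b
    using that by (intro TC_periodic) (simp_all add: pt_RH latt_eq_pt[OF n])
  have "(\<Sum>j\<in>Lam n. complex_of_real (lam n j) * (TC k (pt n j) * cnj (TC l (pt n j)))) =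
      (\<Sum>j\<in>Qlat n. TC k (pt n j) * cnj (TC l (pt n j)))"
  proof (rule sum_Lam_eq_sum_Qlat[OF n])
    fix a b assume "a \<in> Hlat" "b \<in> Hlat" "latcong n a b"
    then show "TC k (pt n a) * cnj (TC l (pt n a)) = TC k (pt n b) * cnj (TC l (pt n b))"
      using per[OF kH] per[OF lH] by metis
  qed (simp add: pt_comp TC_comp)
  also have "\<dots> = (\<Sum>j\<in>Qlat n. (1/576) * (\<Sum>\<sigma>\<in>S4. \<Sum>\<tau>\<in>S4. phi (\<lambda>i. (k \<circ> \<sigma>) i - (l \<circ> \<tau>) i) (pt n j)))"
    unfolding TC_alt by (simp add: sum_product phi_mult_cnj)
  also have "\<dots> = (1/576) * (\<Sum>\<sigma>\<in>S4. \<Sum>\<tau>\<in>S4. \<Sum>j\<in>Qlat n. phi (\<lambda>i. (k \<circ> \<sigma>) i - (l \<circ> \<tau>) i) (pt n j))"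
    unfolding sum_distrib_left[symmetric]
    by (subst sum.swap, intro arg_cong2[where f = "(*)"] refl sum.cong, rule sum.swap)
  also have "\<dots> = (1/576) * (\<Sum>\<sigma>\<in>S4. \<Sum>\<tau>\<in>S4. if latcong n (k \<circ> \<sigma>) (l \<circ> \<tau>) then of_nat (4 * n ^ 3) else 0)"
    by (intro arg_cong2[where f = "(*)"] refl sum.cong)
      (simp only: sum_Qlat_phi[OF n Hlat_diff[OF Hlat_comp[OF kH] Hlat_comp[OF lH]]] c)
  also have "\<dots> = (1/576) * (\<Sum>\<sigma>\<in>S4. of_nat (card {\<tau>\<in>S4. latcong n (k \<circ> \<sigma>) (l \<circ> \<tau>)}) * of_nat (4 * n ^ 3))"
    using finite_S4 by (simp add: sum.If_cases Int_def)
  also have "\<dots> = (1/576) * (\<Sum>\<sigma>\<in>S4. (if k = l then 24 / complex_of_real (lam n k) else 0) * of_nat (4 * n ^ 3))"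
  proof (intro arg_cong2[where f = "(*)"] refl sum.cong)
    fix \<sigma> assume s: "\<sigma> \<in> S4"
    have "real (card {\<tau>\<in>S4. latcong n (k \<circ> \<sigma>) (l \<circ> \<tau>)}) = (if k = l then 24 / lam n k else 0)"
      using cn[OF s] lam0 by (auto simp: field_simps split: if_splits)
    from arg_cong[OF this, of complex_of_real]
    show "of_nat (card {\<tau>\<in>S4. latcong n (k \<circ> \<sigma>) (l \<circ> \<tau>)}) = (if k = l then 24 / complex_of_real (lam n k) else 0)"
      by (simp split: if_splits)
  qed
  also have "\<dots> = (if k = l then 1 / complex_of_real (lam n k) else 0) * of_nat (4 * n ^ 3)"
    by (simp add: card_S4)
  finally show ?thesis unfolding ip_disc_def cub_def using n by simp
qed

subsection \<open>Folding the unit cube onto the alcove\<close>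

lemma emb_simps [simp]:
  "emb p 1 = fst p" "emb p (Suc 0) = fst p" "emb p 2 = fst (snd p)" "emb p 3 = snd (snd p)"
  "emb p 4 = - (fst p + fst (snd p) + snd (snd p))"
  by (auto simp: emb_def)

lemma emb_outside: "i \<notin> {1..4} \<Longrightarrow> emb p i = 0"
  by (auto simp: emb_def)

lemma emb_RH: "emb p \<in> RH"
  by (simp add: RH_def del: One_nat_def)

lemma continuous_emb: "continuous_on UNIV (\<lambda>p. emb p i)"
  by (cases "i = 1 \<or> i = 2 \<or> i = 3 \<or> i = 4") (auto simp: emb_def intro!: continuous_intros)

section \<open>Permutations of the four coordinates preserve Lebesgue measure on R^3\<close>

definition permB :: "(nat \<Rightarrow> nat) \<Rightarrow> real \<times> real \<times> real \<Rightarrow> real \<times> real \<times> real" where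
  "permB \<sigma> p = (emb p (\<sigma> 1), emb p (\<sigma> 2), emb p (\<sigma> 3))"

lemma emb_permB:
  assumes "\<sigma> \<in> S4"
  shows "emb (permB \<sigma> p) = emb p \<circ> \<sigma>"
proof
  fix i :: nat
  have "emb p (\<sigma> 1) + emb p (\<sigma> 2) + emb p (\<sigma> 3) + emb p (\<sigma> 4) = 0"
    using RH_comp[OF emb_RH assms] by (simp add: RH_def)
  then have e4: "emb p (\<sigma> 4) = - (emb p (\<sigma> 1) + emb p (\<sigma> 2) + emb p (\<sigma> 3))" by linarith
  consider "i = 1" | "i = 2" | "i = 3" | "i = 4" | "i \<notin> {1..4}" by force
  then show "emb (permB \<sigma> p) i = (emb p \<circ> \<sigma>) i"
    by cases (simp_all add: permB_def e4 emb_outside S4_outside[OF assms] del: One_nat_def)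
qed

lemma permB_comp: "\<sigma> \<in> S4 \<Longrightarrow> permB (\<sigma> \<circ> \<tau>) p = permB \<tau> (permB \<sigma> p)"
  unfolding permB_def[of \<tau>] emb_permB by (simp add: permB_def)

lemma permB_id: "permB id p = p"
  by (simp add: permB_def)

lemma continuous_permB: "continuous_on UNIV (permB \<sigma>)"
  unfolding permB_def by (intro continuous_intros continuous_emb)

lemma measurable_permB [measurable]: "permB \<sigma> \<in> borel_measurable borel"
  by (rule borel_measurable_continuous_onI[OF continuous_permB])

lemma nn_integral_triple:
  fixes g :: "real \<times> real \<times> real \<Rightarrow> ennreal"
  assumes [measurable]: "g \<in> borel_measurable borel"
  shows "(\<integral>\<^sup>+p. g p \<partial>lborel) = (\<integral>\<^sup>+x. \<integral>\<^sup>+y. \<integral>\<^sup>+z. g (x, y, z) \<partial>lborel \<partial>lborel \<partial>lborel)"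
proof -
  have g: "g \<in> borel_measurable (lborel \<Otimes>\<^sub>M lborel)"
    unfolding lborel_prod by simp
  have "(\<integral>\<^sup>+p. g p \<partial>lborel) = (\<integral>\<^sup>+x. \<integral>\<^sup>+q. g (x, q) \<partial>lborel \<partial>lborel)"
    unfolding lborel.nn_integral_fst[OF g] lborel_prod ..
  moreover have "(\<integral>\<^sup>+q. g (x, q) \<partial>lborel) = (\<integral>\<^sup>+y. \<integral>\<^sup>+z. g (x, y, z) \<partial>lborel \<partial>lborel)" for x
  proof -
    have "(\<lambda>q. g (x, q)) \<in> borel_measurable (lborel \<Otimes>\<^sub>M lborel)"
      unfolding lborel_prod by simp
    from lborel.nn_integral_fst[OF this] show ?thesis unfolding lborel_prod by simp
  qed
  ultimately show ?thesis by simp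
qed

lemma distr_lborelI:
  fixes f :: "'a::euclidean_space \<Rightarrow> 'a"
  assumes [measurable]: "f \<in> borel_measurable borel"
    and e: "\<And>g :: 'a \<Rightarrow> ennreal. g \<in> borel_measurable borel \<Longrightarrow> (\<integral>\<^sup>+p. g (f p) \<partial>lborel) = (\<integral>\<^sup>+p. g p \<partial>lborel)"
  shows "distr lborel borel f = lborel"
proof (rule measure_eqI)
  fix A assume "A \<in> sets (distr lborel borel f)"
  then have A [measurable]: "A \<in> sets borel" by simp
  have "emeasure (distr lborel borel f) A = (\<integral>\<^sup>+p. indicator A p \<partial>distr lborel borel f)"
    by simp
  also have "\<dots> = (\<integral>\<^sup>+p. indicator A (f p) \<partial>lborel)"
    by (rule nn_integral_distr) auto
  also have "\<dots> = (\<integral>\<^sup>+p. indicator A p \<partial>lborel)"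
    by (rule e) simp
  finally show "emeasure (distr lborel borel f) A = emeasure lborel A" by simp
qed simp

text \<open>This transposition and the next one only exchange integration variables, so Fubini
  suffices.\<close>

lemma distr_permB_12: "distr lborel borel (permB (Transposition.transpose 1 2)) = lborel"
proof (rule distr_lborelI)
  fix g :: "real \<times> real \<times> real \<Rightarrow> ennreal" assume g [measurable]: "g \<in> borel_measurable borel"
  have [measurable]: "(\<lambda>p. g (permB (Transposition.transpose 1 2) p)) \<in> borel_measurable borel" by measurable
  have h: "(\<lambda>(x, y). \<integral>\<^sup>+z. g (y, x, z) \<partial>lborel) \<in> borel_measurable (lborel \<Otimes>\<^sub>M lborel)"
    by measurable
  show "(\<integral>\<^sup>+p. g (permB (Transposition.transpose 1 2) p) \<partial>lborel) = (\<integral>\<^sup>+p. g p \<partial>lborel)"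
    unfolding nn_integral_triple[OF g] nn_integral_triple[OF \<open>(\<lambda>p. g (permB (Transposition.transpose 1 2) p)) \<in> borel_measurable borel\<close>]
    using lborel_pair.Fubini'[OF h] by (simp add: permB_def Transposition.transpose_def)
qed simp

lemma distr_permB_23: "distr lborel borel (permB (Transposition.transpose 2 3)) = lborel"
proof (rule distr_lborelI)
  fix g :: "real \<times> real \<times> real \<Rightarrow> ennreal" assume g [measurable]: "g \<in> borel_measurable borel"
  have m: "(\<lambda>p. g (permB (Transposition.transpose 2 3) p)) \<in> borel_measurable borel" by measurable
  have "(\<integral>\<^sup>+y. \<integral>\<^sup>+z. g (x, z, y) \<partial>lborel \<partial>lborel) = (\<integral>\<^sup>+y. \<integral>\<^sup>+z. g (x, y, z) \<partial>lborel \<partial>lborel)" for x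
    by (rule lborel_pair.Fubini') measurable
  then show "(\<integral>\<^sup>+p. g (permB (Transposition.transpose 2 3) p) \<partial>lborel) = (\<integral>\<^sup>+p. g p \<partial>lborel)"
    unfolding nn_integral_triple[OF g] nn_integral_triple[OF m]
    by (simp add: permB_def Transposition.transpose_def)
qed simp

text \<open>Exchange with the dependent fourth coordinate is, for fixed x and y, the reflection of
  the line sending z to -(x + y) - z.\<close>

lemma distr_permB_34: "distr lborel borel (permB (Transposition.transpose 3 4)) = lborel"
proof (rule distr_lborelI)
  fix g :: "real \<times> real \<times> real \<Rightarrow> ennreal" assume g [measurable]: "g \<in> borel_measurable borel"
  have m: "(\<lambda>p. g (permB (Transposition.transpose 3 4) p)) \<in> borel_measurable borel" by measurable
  have "(\<integral>\<^sup>+z. g (x, y, - (x + y) + (-1) * z) \<partial>lborel) = (\<integral>\<^sup>+z. g (x, y, z) \<partial>lborel)" for x y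
    using nn_integral_real_affine[of "\<lambda>z. g (x, y, z)" "-1" "- (x + y)"] by simp
  then show "(\<integral>\<^sup>+p. g (permB (Transposition.transpose 3 4) p) \<partial>lborel) = (\<integral>\<^sup>+p. g p \<partial>lborel)"
    unfolding nn_integral_triple[OF g] nn_integral_triple[OF m]
    by (simp add: permB_def Transposition.transpose_def algebra_simps)
qed simp

lemma distr_permB_comp:
  assumes "\<sigma> \<in> S4" "distr lborel borel (permB \<sigma>) = lborel" "distr lborel borel (permB \<tau>) = lborel"
  shows "distr lborel borel (permB (\<sigma> \<circ> \<tau>)) = lborel"
proof -
  have "permB (\<sigma> \<circ> \<tau>) = permB \<tau> \<circ> permB \<sigma>"
    using permB_comp[OF assms(1)] by (simp add: fun_eq_iff)
  then have "distr lborel borel (permB (\<sigma> \<circ> \<tau>)) = distr (distr lborel borel (permB \<sigma>)) borel (permB \<tau>)"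
    by (simp add: distr_distr)
  then show ?thesis using assms by simp
qed

lemma transpose_S4: "a \<in> {1..4} \<Longrightarrow> b \<in> {1..4} \<Longrightarrow> Transposition.transpose a b \<in> S4"
  unfolding S4_def by (simp add: permutes_swap_id)

lemma distr_permB_transpose:
  assumes "a \<in> {1..4}" "b \<in> {1..4}" "a \<noteq> b"
  shows "distr lborel borel (permB (Transposition.transpose a b)) = lborel"
proof -
  \<comment> \<open>The remaining transpositions are conjugates of adjacent ones; the induction over
    permutations asks for all six.\<close>
  have e: "Transposition.transpose 1 3 = Transposition.transpose 1 2 \<circ> Transposition.transpose 2 3 \<circ> Transposition.transpose 1 (2::nat)"
    "Transposition.transpose 2 4 = Transposition.transpose 2 3 \<circ> Transposition.transpose 3 4 \<circ> Transposition.transpose 2 (3::nat)"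
    "Transposition.transpose 1 4 = Transposition.transpose 1 2 \<circ> (Transposition.transpose 2 3 \<circ> Transposition.transpose 3 4 \<circ> Transposition.transpose 2 3) \<circ> Transposition.transpose 1 (2::nat)"
    by (auto simp: fun_eq_iff Transposition.transpose_def)
  have d13: "distr lborel borel (permB (Transposition.transpose 1 3)) = lborel"
    unfolding e by (intro distr_permB_comp S4_comp transpose_S4 distr_permB_12 distr_permB_23) auto
  have d24: "distr lborel borel (permB (Transposition.transpose 2 4)) = lborel"
    unfolding e by (intro distr_permB_comp S4_comp transpose_S4 distr_permB_34 distr_permB_23) auto
  have d14: "distr lborel borel (permB (Transposition.transpose 1 4)) = lborel"
    unfolding e by (intro distr_permB_comp S4_comp transpose_S4 distr_permB_12 distr_permB_34 distr_permB_23) auto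
  have "a = 1 \<or> a = 2 \<or> a = 3 \<or> a = 4" "b = 1 \<or> b = 2 \<or> b = 3 \<or> b = 4" using assms by auto
  then show ?thesis
    using d13 d24 d14 distr_permB_12 distr_permB_23 distr_permB_34 assms(3) transpose_commute[of a b]
    by (elim disjE) (simp_all del: One_nat_def)
qed

lemma distr_permB:
  assumes "\<sigma> \<in> S4"
  shows "distr lborel borel (permB \<sigma>) = lborel"
proof -
  have "\<sigma> permutes {1..4}" "finite {1..4::nat}" using assms by (simp_all add: S4_def)
  then show ?thesis
  proof (induction rule: permutes_induct)
    case id
    have e: "permB id = (\<lambda>p. p)" by (simp add: permB_id fun_eq_iff)
    show ?case unfolding e by (rule distr_id2) simp
  next
    case (swap a b p)
    then show ?case
      by (intro distr_permB_comp transpose_S4 distr_permB_transpose) auto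
  qed
qed

lemma integral_permB:
  fixes h :: "real \<times> real \<times> real \<Rightarrow> complex"
  assumes "\<sigma> \<in> S4" and [measurable]: "h \<in> borel_measurable borel"
  shows "(\<integral>p. h (permB \<sigma> p) \<partial>lborel) = (\<integral>p. h p \<partial>lborel)"
  using integral_distr[of "permB \<sigma>" lborel borel h] distr_permB[OF assms(1)] by simp

section \<open>The alcove as a compact set of positive volume\<close>

lemma triH3_iff: "p \<in> triH3 \<longleftrightarrow> emb p \<in> triH"
  by (simp add: triH3_def)

text \<open>A coordinate at least 1 would make all the others nonnegative, because the spread is at
  most 1, and the sum positive; symmetrically for -1. The strictness keeps the set
  \<open>shifts\<close> small.\<close>

lemma triH_bounds:
  assumes "x \<in> triH" "i \<in> {1..4}"
  shows "\<bar>x i\<bar> < 1"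
proof -
  have "x 1 + x 2 + x 3 + x 4 = 0" "x 2 \<le> x 1" "x 3 \<le> x 2" "x 4 \<le> x 3" "x 1 \<le> x 4 + 1"
    using assms(1) by (auto simp: triH_def RH_def)
  moreover have "i = 1 \<or> i = 2 \<or> i = 3 \<or> i = 4" using assms(2) by auto
  ultimately show ?thesis unfolding abs_less_iff by (elim disjE) (simp_all only:, linarith+)
qed

lemma triH_cong:
  assumes "\<And>i. i \<in> {1..4} \<Longrightarrow> x i = y i"
  shows "x \<in> triH \<longleftrightarrow> y \<in> triH"
  using assms[of 1] assms[of 2] assms[of 3] assms[of 4] by (simp add: triH_def RH_def)

lemma closed_triH3: "closed triH3"
proof -
  have e: "triH3 = {p. emb p 2 \<le> emb p 1} \<inter> {p. emb p 1 \<le> emb p 2 + 1} \<inter>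
      {p. emb p 3 \<le> emb p 2} \<inter> {p. emb p 2 \<le> emb p 3 + 1} \<inter>
      {p. emb p 4 \<le> emb p 3} \<inter> {p. emb p 3 \<le> emb p 4 + 1} \<inter>
      {p. emb p 4 \<le> emb p 1} \<inter> {p. emb p 1 \<le> emb p 4 + 1}"
    unfolding triH3_def triH_def using emb_RH by auto
  show ?thesis unfolding e
    by (intro closed_Int closed_Collect_le continuous_intros continuous_emb)
qed

lemma triH3_subset: "triH3 \<subseteq> cbox (-1, -1, -1) (1, 1, 1)"
proof
  fix p assume "p \<in> triH3"
  then have "\<bar>emb p i\<bar> < 1" if "i \<in> {1..4}" for i using triH_bounds that by (simp add: triH3_iff)
  from this[of 1] this[of 2] this[of 3] show "p \<in> cbox (-1, -1, -1) (1, 1, 1)"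
    by (cases p) (auto simp: cbox_Pair_eq)
qed

lemma compact_triH3: "compact triH3"
  using closed_triH3 triH3_subset bounded_cbox bounded_subset compact_eq_bounded_closed by blast

lemma measurable_triH3 [measurable]: "triH3 \<in> sets borel"
  using closed_triH3 by simp

lemma measure_triH3_pos: "measure lebesgue triH3 > 0"
proof -
  \<comment> \<open>A small cube around (3/8, 1/8, -1/8), the barycentre of the alcove, where all
    four wall inequalities have slack 1/4.\<close>
  let ?B = "cbox (37/100, 12/100, -13/100) (38/100, 13/100, -12/100) :: (real \<times> real \<times> real) set"
  have "?B \<subseteq> triH3"
  proof
    fix p assume "p \<in> ?B"
    then have "37/100 \<le> fst p" "fst p \<le> 38/100" "12/100 \<le> fst (snd p)" "fst (snd p) \<le> 13/100"
      "-13/100 \<le> snd (snd p)" "snd (snd p) \<le> -12/100"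
      by (cases p; auto simp: cbox_Pair_eq)+
    then show "p \<in> triH3"
      using emb_RH[of p] by (simp add: triH3_iff triH_def)
  qed
  moreover have "measure lebesgue ?B > 0"
    by (simp add: content_Pair)
  moreover have "triH3 \<in> lmeasurable" using compact_triH3 by (rule lmeasurable_compact)
  ultimately show ?thesis
    using measure_mono_fmeasurable[of ?B triH3 lebesgue] by fastforce
qed

lemma continuous_phi_emb: "continuous_on UNIV (\<lambda>p. phi k (emb p))"
  unfolding phi_def by (intro continuous_intros continuous_emb)

lemma measurable_phi_emb [measurable]: "(\<lambda>p. phi k (emb p)) \<in> borel_measurable borel"
  by (rule borel_measurable_continuous_onI[OF continuous_phi_emb])

lemma norm_phi [simp]: "norm (phi k t) = 1"
  by (simp add: phi_cis)

section \<open>Null sets and integrals of exponentials over the cube\<close>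

lemma AE_inner_notin_Ints:
  fixes a :: "'a::euclidean_space"
  assumes "a \<noteq> 0"
  shows "AE q in lborel. a \<bullet> q \<notin> \<int>"
proof -
  have "{q. a \<bullet> q = of_int m} \<in> null_sets lborel" for m
  proof -
    have "negligible {q. a \<bullet> q = of_int m}" using assms by (simp add: negligible_hyperplane)
    moreover have "{q. a \<bullet> q = of_int m} \<in> sets borel" using closed_hyperplane by (rule borel_closed)
    ultimately show ?thesis
      using null_sets_completion_iff[of "{q. a \<bullet> q = of_int m}" lborel]
      by (simp add: negligible_iff_null_sets)
  qed
  then have "(\<Union>m::int. {q. a \<bullet> q = of_int m}) \<in> null_sets lborel"
    by (intro null_sets_UN) auto
  then have "AE q in lborel. q \<notin> (\<Union>m::int. {q. a \<bullet> q = of_int m})" by (rule AE_not_in)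
  then show ?thesis by eventually_elim (auto elim!: Ints_cases)
qed

text \<open>The complement of all reflection planes of the affine Weyl group, where stabilisers are
  trivial.\<close>

definition generic :: "real \<times> real \<times> real \<Rightarrow> bool" where
  "generic q \<longleftrightarrow> (\<forall>i\<in>{1..4}. \<forall>j\<in>{1..4}. i \<noteq> j \<longrightarrow> emb q i - emb q j \<notin> \<int>)"

lemma AE_generic: "AE q in lborel. generic q"
proof -
  have n: "(x - y \<in> \<int>) \<longleftrightarrow> (y - x \<in> \<int>)" for x y :: real
    using minus_in_Ints_iff[of "x - y"] by simp
  \<comment> \<open>Normals of the six coordinate differences; the entry 2 arises because the fourth
    coordinate is minus the sum of the other three.\<close>
  have "AE q in lborel. (1, -1, 0) \<bullet> q \<notin> \<int> \<and> (1, 0, -1) \<bullet> q \<notin> \<int> \<and> (0, 1, -1) \<bullet> q \<notin> \<int> \<and>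
     (2, 1, 1) \<bullet> q \<notin> \<int> \<and> (1, 2, 1) \<bullet> q \<notin> \<int> \<and> (1, 1, 2) \<bullet> (q :: real \<times> real \<times> real) \<notin> \<int>"
    by (intro AE_conjI AE_inner_notin_Ints) (simp_all add: prod_eq_iff)
  then show ?thesis
  proof eventually_elim
    case (elim q)
    have "emb q 1 - emb q 2 = (1, -1, 0) \<bullet> q" "emb q 1 - emb q 3 = (1, 0, -1) \<bullet> q"
      "emb q 2 - emb q 3 = (0, 1, -1) \<bullet> q" "emb q 1 - emb q 4 = (2, 1, 1) \<bullet> q"
      "emb q 2 - emb q 4 = (1, 2, 1) \<bullet> q" "emb q 3 - emb q 4 = (1, 1, 2) \<bullet> q"
      by (simp_all add: inner_prod_def del: One_nat_def)
    then have "emb q 1 - emb q 2 \<notin> \<int>" "emb q 1 - emb q 3 \<notin> \<int>" "emb q 2 - emb q 3 \<notin> \<int>"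
      "emb q 1 - emb q 4 \<notin> \<int>" "emb q 2 - emb q 4 \<notin> \<int>" "emb q 3 - emb q 4 \<notin> \<int>"
      using elim by presburger+
    then show ?case unfolding generic_def ball_14 using n by metis
  qed
qed

lemma integral_cis:
  "integral {0..1} (\<lambda>x. cis (2 * pi * of_int m * x)) = (if m = 0 then 1 else 0)"
proof (cases "m = 0")
  case False
  define c where "c = 2 * pi * of_int m"
  have c0: "c \<noteq> 0" using False by (simp add: c_def)
  have "((\<lambda>x. exp (\<i> * of_real c * of_real x) / (\<i> * of_real c)) has_vector_derivative
      exp (\<i> * of_real c * of_real x)) (at x within {0..1})" for x :: real
    by (rule has_vector_derivative_real_field) (use c0 in \<open>auto intro!: derivative_eq_intros\<close>)
  then have I: "((\<lambda>x. exp (\<i> * of_real c * of_real x)) has_integral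
      exp (\<i> * of_real c * of_real 1) / (\<i> * of_real c) - exp (\<i> * of_real c * of_real 0) / (\<i> * of_real c)) {0..1::real}"
    by (intro fundamental_theorem_of_calculus) auto
  have E: "exp (\<i> * of_real c * of_real x) = cis (c * x)" for x
    by (simp add: cis_conv_exp mult.assoc)
  have "cis (c * 1) = 1" using cis_multiple_2pi[of "of_int m"] by (simp add: c_def mult.assoc)
  then have "((\<lambda>x. cis (c * x)) has_integral 0) {0..1::real}"
    using I unfolding E by simp
  then show ?thesis using False unfolding c_def by (simp add: integral_unique)
qed simp

text \<open>In these coordinates the exponential is a product of three functions of period 1. If all
  three frequencies vanished, the entries of \<open>k\<close> would be equal and, by the zero sum,
  zero.\<close>

lemma integral_phi_cube:
  assumes k: "k \<in> Hlat" "k \<noteq> (\<lambda>_. 0)"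
  shows "integral (cbox (0, 0, 0) (1, 1, 1)) (\<lambda>p. phi k (emb p)) = 0"
proof -
  have k0: "k 1 + k 2 + k 3 + k 4 = 0" using k by (simp add: Hlat_def)
  have "4 dvd k 1 - k 4" "4 dvd k 2 - k 4" "4 dvd k 3 - k 4"
    using k by (auto simp: Hlat_def mod_eq_dvd_iff[symmetric])
  then obtain m1 m2 m3 where m: "k 1 = k 4 + 4 * m1" "k 2 = k 4 + 4 * m2" "k 3 = k 4 + 4 * m3"
    by (metis dvdE diff_add_cancel add.commute)
  define e where "e q x = cis (2 * pi * of_int q * x)" for q x
  have ph: "phi k (emb (x, y, z)) = e m1 x * (e m2 y * e m3 z)" for x y z
  proof -
    have "(\<Sum>i\<in>{1..4}. real_of_int (k i) * emb (x, y, z) i) =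
       4 * (of_int m1 * x + (of_int m2 * y + of_int m3 * z))"
      unfolding sum_14 m(1) m(2) m(3) by (simp add: algebra_simps)
    then show ?thesis unfolding phi_cis e_def cis_mult by (simp add: algebra_simps)
  qed
  have c: "continuous_on S (\<lambda>p. phi k (emb p))" for S
    using continuous_phi_emb continuous_on_subset by blast
  have "integral (cbox (0, 0, 0) (1, 1, 1)) (\<lambda>p. phi k (emb p)) =
      integral (cbox 0 1) (\<lambda>x. integral (cbox (0, 0) (1, 1)) (\<lambda>q. phi k (emb (x, q))))"
    by (rule integral_prod_continuous[OF c])
  also have "\<dots> = integral (cbox 0 1) (\<lambda>x. integral (cbox 0 1) (\<lambda>y. integral (cbox 0 1) (\<lambda>z. phi k (emb (x, y, z)))))"
  proof (intro integral_cong integral_prod_continuous)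
    fix x :: real
    show "continuous_on (cbox (0, 0) (1, 1)) (\<lambda>q. phi k (emb (x, q)))"
      by (rule continuous_on_compose2[OF continuous_phi_emb]) (auto intro!: continuous_intros)
  qed
  also have "\<dots> = integral {0..1} (e m1) * (integral {0..1} (e m2) * integral {0..1} (e m3))"
    unfolding ph by simp
  also have "\<dots> = (if m1 = 0 then 1 else 0) * ((if m2 = 0 then 1 else 0) * (if m3 = 0 then 1 else 0))"
    unfolding e_def integral_cis ..
  also have "\<dots> = 0"
  proof -
    have "\<not> (m1 = 0 \<and> m2 = 0 \<and> m3 = 0)"
    proof
      assume "m1 = 0 \<and> m2 = 0 \<and> m3 = 0"
      then have "k 1 = 0" "k 2 = 0" "k 3 = 0" "k 4 = 0" using m k0 by auto
      then have "\<forall>i\<in>{1..4}. k i = 0" unfolding ball_14 by simp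
      then have "k = (\<lambda>_. 0)" using k(1) unfolding Hlat_iff by (auto simp: fun_eq_iff)
      then show False using k(2) by contradiction
    qed
    then show ?thesis by auto
  qed
  finally show ?thesis .
qed

section \<open>Unfolding of the integral over the alcove\<close>

abbreviation unit_cube :: "(real \<times> real \<times> real) set" where
  "unit_cube \<equiv> box (0, 0, 0) (1, 1, 1)"

text \<open>A coordinate in (-1, 1) minus one in (0, 1) that is an integer can only be -1 or 0, so
  these eight translations link the cube with all permuted alcoves.\<close>

definition shifts :: "(real \<times> real \<times> real) set" where
  "shifts = {-1, 0} \<times> {-1, 0} \<times> {-1, 0}"

lemma emb_add: "emb (p + q) i = emb p i + emb q i"
  by (simp add: emb_def)

lemma shifts_Ints: "m \<in> shifts \<Longrightarrow> emb m i \<in> \<int>"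
  by (auto simp: shifts_def emb_def)

lemma mem_unit_cube: "q \<in> unit_cube \<longleftrightarrow> (\<forall>i\<in>{1,2,3}. 0 < emb q i \<and> emb q i < 1)"
  by (cases q) (auto simp: box_def Basis_prod_def)

lemma emb_eqI:
  assumes "\<And>i. i \<in> {1,2,3} \<Longrightarrow> emb p i = emb q i"
  shows "p = q"
  using assms[of 1] assms[of 2] assms[of 3] by (simp add: prod_eq_iff)

text \<open>\<open>triH_exists\<close> gives one pair of permutation and shift. Any other pair
  reaches the same alcove point by \<open>triH_unique\<close>, and genericity then forces the same
  permutation, hence the same shift.\<close>

lemma fold_count:
  assumes q: "q \<in> unit_cube" and g: "generic q"
  shows "(\<Sum>\<sigma>\<in>S4. \<Sum>m\<in>shifts. indicator triH3 (permB \<sigma> (q + m))) = (1 :: real)"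
proof -
  obtain \<sigma> y where s: "\<sigma> \<in> S4" and y: "y \<in> triH" and e: "latt_eq y (emb q \<circ> \<sigma>)"
    using triH_exists[OF emb_RH] by blast
  \<comment> \<open>Translation is applied before permutation, so the alcove point is permuted back
    before it is compared with \<open>q\<close>.\<close>
  define m where "m = (y (inv \<sigma> 1) - emb q 1, y (inv \<sigma> 2) - emb q 2, y (inv \<sigma> 3) - emb q 3)"
  have inv14: "inv \<sigma> i \<in> {1..4}" if "i \<in> {1..4}" for i
    using S4_range[OF S4_inv[OF s] that] .
  have "y (inv \<sigma> 1) + y (inv \<sigma> 2) + y (inv \<sigma> 3) + y (inv \<sigma> 4) = 0"
    using RH_comp[of y "inv \<sigma>"] y S4_inv[OF s] by (simp add: triH_def RH_def)
  moreover have "emb q 1 + emb q 2 + emb q 3 + emb q 4 = 0"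
    using emb_RH[of q] by (simp add: RH_def)
  ultimately have qm: "emb (q + m) i = y (inv \<sigma> i)" if "i \<in> {1..4}" for i
  proof -
    have "i = 1 \<or> i = 2 \<or> i = 3 \<or> i = 4" using that by auto
    then show ?thesis
      using \<open>y (inv \<sigma> 1) + y (inv \<sigma> 2) + y (inv \<sigma> 3) + y (inv \<sigma> 4) = 0\<close>
      by (elim disjE) (simp_all add: emb_add m_def del: One_nat_def, linarith?)
  qed
  have m: "m \<in> shifts"
  proof -
    have "emb m i \<in> {-1, 0}" if i: "i \<in> {1,2,3}" for i
    proof -
      have i4: "i \<in> {1..4}" using i by auto
      have ei: "emb m i = y (inv \<sigma> i) - emb q i" using qm[OF i4] by (simp add: emb_add)
      have "y (inv \<sigma> i) - emb q (\<sigma> (inv \<sigma> i)) \<in> \<int>" using e inv14[OF i4] unfolding latt_eq_def by simp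
      then have "y (inv \<sigma> i) - emb q i \<in> \<int>" using s by simp
      then obtain z where z: "y (inv \<sigma> i) - emb q i = of_int z" by (elim Ints_cases)
      have "\<bar>y (inv \<sigma> i)\<bar> < 1" by (rule triH_bounds[OF y inv14[OF i4]])
      moreover have "0 < emb q i" "emb q i < 1" using q i unfolding mem_unit_cube by auto
      ultimately have "-2 < real_of_int z" "real_of_int z < 1" using z by linarith+
      then have "z = -1 \<or> z = 0" by linarith
      then show ?thesis using ei z by auto
    qed
    from this[of 1] this[of 2] this[of 3] show ?thesis
      unfolding shifts_def mem_Times_iff by simp
  qed
  have ex: "permB \<sigma> (q + m) \<in> triH3"
  proof -
    have "emb (permB \<sigma> (q + m)) i = y i" if "i \<in> {1..4}" for i
      unfolding emb_permB[OF s] o_def using qm[OF S4_range[OF s that]] s by simp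
    then show ?thesis using y triH_cong unfolding triH3_iff by blast
  qed
  have un: "\<tau> = \<sigma> \<and> m' = m" if t: "\<tau> \<in> S4" and m': "m' \<in> shifts" and h: "permB \<tau> (q + m') \<in> triH3" for \<tau> m'
  proof -
    define x where "x = emb (q + m) \<circ> \<sigma>"
    define x' where "x' = emb (q + m') \<circ> \<tau>"
    have xt: "x \<in> triH" "x' \<in> triH"
      using ex h unfolding triH3_iff emb_permB[OF s] emb_permB[OF t] x_def x'_def by auto
    have "latt_eq x' (x \<circ> (inv \<sigma> \<circ> \<tau>))"
      unfolding latt_eq_def x_def x'_def using s shifts_Ints[OF m] shifts_Ints[OF m']
      by (simp add: emb_add)
    from triH_unique[OF xt S4_comp[OF S4_inv[OF s] t] this]
    have xx: "emb q (\<sigma> i) + emb m (\<sigma> i) = emb q (\<tau> i) + emb m' (\<tau> i)" if "i \<in> {1..4}" for i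
      using that by (simp add: x_def x'_def emb_add)
    have st: "\<sigma> i = \<tau> i" if i: "i \<in> {1..4}" for i
    \<comment> \<open>Different images of one index would make two coordinates of \<open>q\<close>
      differ by an integer.\<close>
    proof (rule ccontr)
      assume "\<sigma> i \<noteq> \<tau> i"
      then have "emb q (\<sigma> i) - emb q (\<tau> i) \<notin> \<int>"
        using g S4_range[OF s i] S4_range[OF t i] unfolding generic_def by blast
      moreover have "emb q (\<sigma> i) - emb q (\<tau> i) = emb m' (\<tau> i) - emb m (\<sigma> i)"
        using xx[OF i] by linarith
      ultimately show False using Ints_diff[OF shifts_Ints[OF m'] shifts_Ints[OF m]] by metis
    qed
    have "\<tau> i = \<sigma> i" for i
      using st S4_outside[OF s] S4_outside[OF t] by (cases "i \<in> {1..4}") auto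
    then have ts: "\<tau> = \<sigma>" by (simp add: fun_eq_iff)
    have "emb m' i = emb m i" if "i \<in> {1,2,3}" for i
    proof -
      have "inv \<sigma> i \<in> {1..4}" using inv14[of i] that by auto
      from xx[OF this] show ?thesis using s ts by simp
    qed
    then show ?thesis using ts emb_eqI by blast
  qed
  have z: "(\<Sum>m'\<in>shifts. indicator triH3 (permB \<tau> (q + m'))) = (if \<tau> = \<sigma> then 1 else (0::real))"
    if t: "\<tau> \<in> S4" for \<tau>
  proof -
    have "(\<Sum>m'\<in>shifts. indicator triH3 (permB \<tau> (q + m'))) = (\<Sum>m'\<in>shifts. if m' = m then (if \<tau> = \<sigma> then 1 else (0::real)) else 0)"
    proof (rule sum.cong[OF refl])
      fix m' assume m': "m' \<in> shifts"
      have "permB \<tau> (q + m') \<in> triH3 \<longleftrightarrow> \<tau> = \<sigma> \<and> m' = m" using un[OF t m'] ex by blast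
      then show "indicator triH3 (permB \<tau> (q + m')) = (if m' = m then (if \<tau> = \<sigma> then 1 else (0::real)) else 0)"
        unfolding indicator_def by simp
    qed
    also have "\<dots> = (if \<tau> = \<sigma> then 1 else 0)" using m by (simp add: shifts_def)
    finally show ?thesis .
  qed
  have "(\<Sum>\<tau>\<in>S4. \<Sum>m'\<in>shifts. indicator triH3 (permB \<tau> (q + m'))) = (\<Sum>\<tau>\<in>S4. if \<tau> = \<sigma> then 1 else (0::real))"
    by (rule sum.cong[OF refl z])
  also have "\<dots> = 1" using s finite_S4 by simp
  finally show ?thesis .
qed

lemma AE_coords: "AE q in lborel. \<forall>i\<in>{1,2,3}. emb q i \<notin> \<int>"
proof -
  have "AE q in lborel. (1, 0, 0) \<bullet> q \<notin> \<int> \<and> (0, 1, 0) \<bullet> q \<notin> \<int> \<and> (0, 0, 1) \<bullet> (q :: real \<times> real \<times> real) \<notin> \<int>"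
    by (intro AE_conjI AE_inner_notin_Ints) (simp_all add: prod_eq_iff)
  then show ?thesis by eventually_elim (simp add: inner_prod_def)
qed

lemma measurable_unit_cube [measurable]: "unit_cube \<in> sets borel"
  by (rule borel_open[OF open_box])

lemma integral_translate:
  fixes h :: "real \<times> real \<times> real \<Rightarrow> complex"
  assumes [measurable]: "h \<in> borel_measurable borel"
  shows "(\<integral>p. h (p + m) \<partial>lborel) = (\<integral>p. h p \<partial>lborel)"
  using integral_distr[of "(+) m" lborel borel h] lborel_distr_plus[of m] by (simp add: add.commute)

text \<open>The one contributing shift is the vector of floors. Integer coordinates are excluded
  because the cubes are open.\<close>

lemma shift_decomposition:
  assumes "\<And>i. i \<in> {1,2,3} \<Longrightarrow> \<bar>emb q i\<bar> < 1" "\<And>i. i \<in> {1,2,3} \<Longrightarrow> emb q i \<notin> \<int>"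
  shows "(\<Sum>m\<in>shifts. indicator unit_cube (q - m)) = (1::real)"
proof -
  define m :: "real \<times> real \<times> real" where
    "m = (of_int \<lfloor>emb q 1\<rfloor>, of_int \<lfloor>emb q 2\<rfloor>, of_int \<lfloor>emb q 3\<rfloor>)"
  have em: "emb m i = of_int \<lfloor>emb q i\<rfloor>" if "i \<in> {1,2,3}" for i
    using that by (auto simp: m_def)
  have fl: "\<lfloor>emb q i\<rfloor> = -1 \<or> \<lfloor>emb q i\<rfloor> = 0" if "i \<in> {1,2,3}" for i
    using assms(1)[OF that] by linarith
  have emb_diff: "emb (q - m') i = emb q i - emb m' i" for m' i
    using emb_add[of "q - m'" m' i] by simp
  have ms: "m \<in> shifts"
    using fl[of 1] fl[of 2] fl[of 3] unfolding shifts_def mem_Times_iff m_def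
    by (simp del: emb_simps) (metis of_int_0 of_int_1 of_int_minus)
  have "q - m' \<in> unit_cube \<longleftrightarrow> m' = m" if m': "m' \<in> shifts" for m'
  proof
    assume "q - m' \<in> unit_cube"
    then have b: "emb m' i < emb q i \<and> emb q i < emb m' i + 1" if "i \<in> {1,2,3}" for i
      using that unfolding mem_unit_cube emb_diff by force
    show "m' = m"
    proof (rule emb_eqI)
      fix i :: nat assume i: "i \<in> {1,2,3}"
      obtain z where z: "emb m' i = of_int z" using shifts_Ints[OF m', of i] by (elim Ints_cases)
      have "\<lfloor>emb q i\<rfloor> = z" using b[OF i] unfolding z by linarith
      then show "emb m' i = emb m i" using em[OF i] z by simp
    qed
  next
    assume "m' = m"
    moreover have "0 < emb q i - of_int \<lfloor>emb q i\<rfloor> \<and> emb q i - of_int \<lfloor>emb q i\<rfloor> < 1" if "i \<in> {1,2,3}" for i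
    proof -
      have "emb q i \<noteq> of_int \<lfloor>emb q i\<rfloor>" using assms(2)[OF that] Ints_of_int by metis
      then show ?thesis by linarith
    qed
    ultimately show "q - m' \<in> unit_cube" unfolding mem_unit_cube emb_diff using em by simp
  qed
  then have "(\<Sum>m'\<in>shifts. indicator unit_cube (q - m')) = (\<Sum>m'\<in>shifts. if m' = m then 1 else (0::real))"
    by (intro sum.cong) (auto simp: indicator_def)
  also have "\<dots> = 1" using ms by (simp add: shifts_def)
  finally show ?thesis .
qed


lemma integrable_triH3:
  fixes f :: "real \<times> real \<times> real \<Rightarrow> complex"
  assumes "continuous_on UNIV f"
  shows "integrable lborel (\<lambda>p. indicator triH3 p *\<^sub>R f p)" "f integrable_on triH3"
    "integral triH3 f = (\<integral>p. indicator triH3 p *\<^sub>R f p \<partial>lborel)"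
proof -
  show 1: "integrable lborel (\<lambda>p. indicator triH3 p *\<^sub>R f p)"
    by (rule borel_integrable_compact[OF compact_triH3 continuous_on_subset[OF assms]]) simp
  then have "set_integrable lborel triH3 f" by (simp add: set_integrable_def)
  from set_borel_integral_eq_integral[OF this]
  show "f integrable_on triH3" "integral triH3 f = (\<integral>p. indicator triH3 p *\<^sub>R f p \<partial>lborel)"
    by (simp_all add: set_lebesgue_integral_def)
qed

lemma emb_phi_shift:
  assumes "k \<in> Hlat" "m \<in> shifts"
  shows "phi k (emb (p + m)) = phi k (emb p)"
  by (rule phi_periodic[OF assms(1) emb_RH emb_RH])
    (simp add: latt_eq_def emb_add shifts_Ints[OF assms(2)])

text \<open>The permuted alcove is cut by the eight translated cubes, and each piece is moved back
  into the unit cube; periodicity leaves the exponential unchanged.\<close>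

lemma integral_fold:
  assumes k: "k \<in> Hlat" and s: "\<sigma> \<in> S4"
  shows "(\<integral>p. indicator triH3 (permB \<sigma> p) *\<^sub>R phi k (emb p) \<partial>lborel) =
    (\<Sum>m\<in>shifts. \<integral>p. (indicator unit_cube p * indicator triH3 (permB \<sigma> (p + m))) *\<^sub>R phi k (emb p) \<partial>lborel)"
proof -
  define h where "h m p = (indicator unit_cube (p - m) * indicator triH3 (permB \<sigma> p)) *\<^sub>R phi k (emb p)" for m p
  have [measurable]: "h m \<in> borel_measurable borel" for m
    unfolding h_def by measurable
  have "integrable lborel (indicator triH3 :: _ \<Rightarrow> real)"
    using borel_integrable_compact[OF compact_triH3, of "\<lambda>_. 1::real"] by simp
  then have i: "integrable lborel (\<lambda>p. indicator triH3 (permB \<sigma> p) :: real)"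
    using integrable_distr_eq[of "permB \<sigma>" lborel borel "indicator triH3 :: _ \<Rightarrow> real"] distr_permB[OF s] by simp
  have hi: "integrable lborel (h m)" for m
  proof (rule Bochner_Integration.integrable_bound[OF i])
    show "AE p in lborel. norm (h m p) \<le> norm (indicator triH3 (permB \<sigma> p) :: real)"
      by (rule AE_I2) (auto simp: h_def indicator_def)
  qed simp
  have "(\<integral>p. indicator triH3 (permB \<sigma> p) *\<^sub>R phi k (emb p) \<partial>lborel) = (\<integral>p. (\<Sum>m\<in>shifts. h m p) \<partial>lborel)"
  proof (rule integral_cong_AE)
    show "AE p in lborel. indicator triH3 (permB \<sigma> p) *\<^sub>R phi k (emb p) = (\<Sum>m\<in>shifts. h m p)"
      using AE_coords
    proof eventually_elim
      case (elim p)
      have e: "(\<Sum>m\<in>shifts. h m p) = ((\<Sum>m\<in>shifts. indicator unit_cube (p - m)) * indicator triH3 (permB \<sigma> p)) *\<^sub>R phi k (emb p)"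
        unfolding h_def scaleR_sum_left sum_distrib_right ..
      show ?case
      proof (cases "permB \<sigma> p \<in> triH3")
        case True
        have "\<bar>emb p i\<bar> < 1" if "i \<in> {1,2,3}" for i
        proof -
          have "inv \<sigma> i \<in> {1..4}" using S4_range[OF S4_inv[OF s], of i] that by auto
          moreover have "emb p \<circ> \<sigma> \<in> triH" using True unfolding triH3_iff emb_permB[OF s] .
          ultimately have "\<bar>(emb p \<circ> \<sigma>) (inv \<sigma> i)\<bar> < 1" by (intro triH_bounds)
          then show ?thesis using s by simp
        qed
        then have "(\<Sum>m\<in>shifts. indicator unit_cube (p - m)) = (1::real)"
          using elim by (intro shift_decomposition) blast+
        then show ?thesis unfolding e by simp
      qed (simp add: e)
    qed
  qed measurable
  also have "\<dots> = (\<Sum>m\<in>shifts. \<integral>p. h m p \<partial>lborel)"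
    by (rule Bochner_Integration.integral_sum) (rule hi)
  also have "\<dots> = (\<Sum>m\<in>shifts. \<integral>p. (indicator unit_cube p * indicator triH3 (permB \<sigma> (p + m))) *\<^sub>R phi k (emb p) \<partial>lborel)"
  proof (rule sum.cong[OF refl])
    fix m assume m: "m \<in> shifts"
    have "(\<integral>p. h m p \<partial>lborel) = (\<integral>p. h m (p + m) \<partial>lborel)"
      by (rule integral_translate[symmetric]) simp
    then show "(\<integral>p. h m p \<partial>lborel) = (\<integral>p. (indicator unit_cube p * indicator triH3 (permB \<sigma> (p + m))) *\<^sub>R phi k (emb p) \<partial>lborel)"
      by (simp add: h_def emb_phi_shift[OF k m])
  qed
  finally show ?thesis .
qed

text \<open>The 24 permuted alcoves, each cut into eight pieces, cover almost every point of the
  unit cube once, so the integral is 1/24 of that of \<open>phi k\<close> over the cube.\<close>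

lemma integral_TC_triH3:
  assumes k: "k \<in> Hlat" "k \<noteq> (\<lambda>_. 0)"
  shows "integral triH3 (TC k \<circ> emb) = 0"
proof -
  define J where "J \<sigma> = (\<integral>p. indicator triH3 (permB \<sigma> p) *\<^sub>R phi k (emb p) \<partial>lborel)" for \<sigma>
  define T where "T \<sigma> m p = (indicator unit_cube p * indicator triH3 (permB \<sigma> (p + m))) *\<^sub>R phi k (emb p)" for \<sigma> m p
  have ci: "continuous_on UNIV (\<lambda>p. phi k (emb p \<circ> \<sigma>))" for \<sigma>
    unfolding phi_def o_def by (intro continuous_intros continuous_emb)
  have cT: "continuous_on UNIV (TC k \<circ> emb)"
    unfolding TC_def o_def[of _ emb] by (intro continuous_intros ci)
  have [measurable]: "T \<sigma> m \<in> borel_measurable borel" for \<sigma> m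
    unfolding T_def by measurable
  have iC: "integrable lborel (indicator unit_cube :: _ \<Rightarrow> real)"
    using emeasure_bounded_finite[OF bounded_box, of "(0,0,0)" "(1,1,1) :: real \<times> real \<times> real"]
    by (intro integrable_real_indicator) auto
  have Ti: "integrable lborel (T \<sigma> m)" for \<sigma> m
  proof (rule Bochner_Integration.integrable_bound[OF iC])
    show "AE p in lborel. norm (T \<sigma> m p) \<le> norm (indicator unit_cube p :: real)"
      by (rule AE_I2) (auto simp: T_def indicator_def)
  qed simp
  \<comment> \<open>The measure-preserving substitution by \<open>permB \<sigma>\<close> moves the
    permutation from the exponential to the domain.\<close>
  have Js: "(\<integral>p. indicator triH3 p *\<^sub>R phi k (emb p \<circ> \<sigma>) \<partial>lborel) = J (inv \<sigma>)" if s: "\<sigma> \<in> S4" for \<sigma>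
  proof -
    have "permB (inv \<sigma>) (permB \<sigma> p) = p" for p
      using permB_comp[OF s, of "inv \<sigma>" p] s by (simp add: permB_id)
    then have "(\<integral>p. indicator triH3 p *\<^sub>R phi k (emb p \<circ> \<sigma>) \<partial>lborel) =
       (\<integral>p. indicator triH3 (permB (inv \<sigma>) (permB \<sigma> p)) *\<^sub>R phi k (emb (permB \<sigma> p)) \<partial>lborel)"
      by (simp add: emb_permB[OF s])
    also have "\<dots> = J (inv \<sigma>)"
      unfolding J_def by (rule integral_permB[OF s]) measurable
    finally show ?thesis .
  qed
  have "integral triH3 (TC k \<circ> emb) = (\<integral>p. (1/24) * (\<Sum>\<sigma>\<in>S4. indicator triH3 p *\<^sub>R phi k (emb p \<circ> \<sigma>)) \<partial>lborel)"
    unfolding integrable_triH3(3)[OF cT]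
    by (intro Bochner_Integration.integral_cong refl) (simp add: TC_def scaleR_sum_right)
  also have "\<dots> = (1/24) * (\<Sum>\<sigma>\<in>S4. \<integral>p. indicator triH3 p *\<^sub>R phi k (emb p \<circ> \<sigma>) \<partial>lborel)"
    by (simp add: Bochner_Integration.integral_sum integrable_triH3(1)[OF ci])
  also have "\<dots> = (1/24) * (\<Sum>\<sigma>\<in>S4. J (inv \<sigma>))"
    by (simp add: Js)
  also have "(\<Sum>\<sigma>\<in>S4. J (inv \<sigma>)) = (\<Sum>\<sigma>\<in>S4. J \<sigma>)"
    by (rule sum_over_S4_inv)
  also have "\<dots> = (\<Sum>\<sigma>\<in>S4. \<Sum>m\<in>shifts. \<integral>p. T \<sigma> m p \<partial>lborel)"
    unfolding J_def T_def by (intro sum.cong refl integral_fold k(1))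
  also have "\<dots> = (\<integral>p. (\<Sum>\<sigma>\<in>S4. \<Sum>m\<in>shifts. T \<sigma> m p) \<partial>lborel)"
    by (simp add: Bochner_Integration.integral_sum Ti)
  also have "\<dots> = (\<integral>p. indicator unit_cube p *\<^sub>R phi k (emb p) \<partial>lborel)"
  proof (rule integral_cong_AE)
    show "AE p in lborel. (\<Sum>\<sigma>\<in>S4. \<Sum>m\<in>shifts. T \<sigma> m p) = indicator unit_cube p *\<^sub>R phi k (emb p)"
      using AE_generic
    proof eventually_elim
      case (elim p)
      have "(\<Sum>\<sigma>\<in>S4. \<Sum>m\<in>shifts. T \<sigma> m p) = (indicator unit_cube p *
          (\<Sum>\<sigma>\<in>S4. \<Sum>m\<in>shifts. indicator triH3 (permB \<sigma> (p + m)))) *\<^sub>R phi k (emb p)"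
        unfolding T_def scaleR_sum_left sum_distrib_left ..
      then show ?case using fold_count[OF _ elim] by (cases "p \<in> unit_cube") simp_all
    qed
  qed measurable
  also have "\<dots> = integral unit_cube (\<lambda>p. phi k (emb p))"
  proof -
    have "set_integrable lborel unit_cube (\<lambda>p. phi k (emb p))"
      unfolding set_integrable_def
    proof (rule Bochner_Integration.integrable_bound[OF iC])
      show "AE p in lborel. norm (indicator unit_cube p *\<^sub>R phi k (emb p)) \<le> norm (indicator unit_cube p :: real)"
        by (rule AE_I2) simp
    qed measurable
    from set_borel_integral_eq_integral(2)[OF this] show ?thesis
      by (simp add: set_lebesgue_integral_def)
  qed
  also have "\<dots> = 0"
    unfolding integral_open_interval by (rule integral_phi_cube[OF k])
  finally show ?thesis by (simp add: o_def)
qed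

section \<open>Comparison of the two averages\<close>

lemma TC_zero: "TC (\<lambda>_. 0) t = 1"
  by (simp add: TC_def phi_cis card_S4)

lemma avg_TC:
  assumes "k \<in> Hlat"
  shows "avg_tri (TC k) = (if k = (\<lambda>_. 0) then 1 else 0)"
proof (cases "k = (\<lambda>_. 0)")
  case True
  have l: "triH3 \<in> lmeasurable" using compact_triH3 by (rule lmeasurable_compact)
  then have "((\<lambda>x. 1::real) has_integral measure lebesgue triH3) triH3"
    using lmeasure_integral[OF l] lmeasurable_iff_integrable_on[of triH3]
    by (simp add: has_integral_iff)
  from has_integral_linear[OF this bounded_linear_of_real]
  have "((\<lambda>x. 1::complex) has_integral of_real (measure lebesgue triH3)) triH3"
    by (simp add: o_def)
  then show ?thesis
    using measure_triH3_pos True by (simp add: avg_tri_def TC_zero o_def integral_unique)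
qed (simp add: avg_tri_def integral_TC_triH3[OF assms])

lemma avg_eq_cub:
  assumes n: "n \<ge> 1" and f: "inTC (2 * n - 1) f"
  shows "avg_tri f = cub n f"
proof -
  define L where "L = Lam (2 * n - 1)"
  obtain c where c: "\<And>t. t \<in> RH \<Longrightarrow> f t = (\<Sum>k\<in>L. c k * TC k t)"
    using f unfolding inTC_def L_def by blast
  have LH: "k \<in> Hlat" if "k \<in> L" for k using that by (simp add: L_def Lam_def)
  have fL: "finite L" unfolding L_def by (rule finite_Lam)
  \<comment> \<open>Divided by 4n, such a \<open>k\<close> is a decreasing integer vector of sum
    zero. A nonzero one has spread at least 2, that is, at least 8n before division, whereas
    \<open>Lam (2 * n - 1)\<close> allows 8n - 4.\<close>
  have L0: "latcong n k (\<lambda>_. 0) \<longleftrightarrow> k = (\<lambda>_. 0)" if k: "k \<in> L" for k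
  proof
    assume "latcong n k (\<lambda>_. 0)"
    then have "4 * int n dvd k 1" "4 * int n dvd k 2" "4 * int n dvd k 3" "4 * int n dvd k 4"
      by (auto simp: latcong_def)
    then obtain a b c d where m: "k 1 = 4 * int n * a" "k 2 = 4 * int n * b" "k 3 = 4 * int n * c" "k 4 = 4 * int n * d"
      by (elim dvdE)
    have N: "4 * int n > 0" using n by simp
    have o: "k 4 \<le> k 3" "k 3 \<le> k 2" "k 2 \<le> k 1" "k 1 \<le> k 4 + 4 * int (2 * n - 1)" "k 1 + k 2 + k 3 + k 4 = 0"
      using k by (auto simp: L_def Lam_def Hlat_def)
    have "d \<le> c" "c \<le> b" "b \<le> a" using o(1-3) N unfolding m by simp_all
    moreover have "k 1 < k 4 + 4 * int n * 2" using o(4) n by simp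
    then have "4 * int n * a < 4 * int n * (d + 2)" unfolding m by (simp add: algebra_simps)
    then have "a < d + 2" using N by simp
    moreover have "4 * int n * (a + b + c + d) = 0" using o(5) unfolding m by (simp add: algebra_simps)
    then have "a + b + c + d = 0" using N by simp
    ultimately have z: "d \<le> c" "c \<le> b" "b \<le> a" "a < d + 2" "a + b + c + d = 0" by blast+
    then have "d \<le> 0" "0 \<le> d" by linarith+
    with z have "a = 0" "b = 0" "c = 0" "d = 0" by linarith+
    then have "\<forall>i\<in>{1..4}. k i = 0" unfolding ball_14 m by simp
    then show "k = (\<lambda>_. 0)" using LH[OF k] unfolding Hlat_iff by (auto simp: fun_eq_iff)
  qed (simp add: latcong_refl)
  have cT: "continuous_on UNIV (\<lambda>p. TC k (emb p))" for k
    unfolding TC_def phi_def o_def by (intro continuous_intros continuous_emb)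
  have "avg_tri f = integral triH3 (\<lambda>p. \<Sum>k\<in>L. c k * TC k (emb p)) / of_real (measure lebesgue triH3)"
    unfolding avg_tri_def o_def by (simp add: c emb_RH)
  also have "integral triH3 (\<lambda>p. \<Sum>k\<in>L. c k * TC k (emb p)) = (\<Sum>k\<in>L. integral triH3 (\<lambda>p. c k * TC k (emb p)))"
    by (rule integral_sum[OF fL]) (intro integrable_triH3(2) continuous_intros cT)
  also have "\<dots> = (\<Sum>k\<in>L. c k * integral triH3 (TC k \<circ> emb))"
    by (simp add: o_def)
  also have "\<dots> / of_real (measure lebesgue triH3) = (\<Sum>k\<in>L. c k * avg_tri (TC k))"
    by (simp add: avg_tri_def sum_divide_distrib)
  also have "\<dots> = (\<Sum>k\<in>L. c k * cub n (TC k))"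
    by (rule sum.cong[OF refl]) (simp add: avg_TC cub_TC[OF n] LH L0)
  also have "\<dots> = cub n f"
  proof -
    have "(\<Sum>j\<in>Lam n. complex_of_real (lam n j) * f (pt n j)) =
        (\<Sum>j\<in>Lam n. \<Sum>k\<in>L. c k * (complex_of_real (lam n j) * TC k (pt n j)))"
    proof (rule sum.cong[OF refl])
      fix j assume "j \<in> Lam n"
      then have "pt n j \<in> RH" using Lam_iff[OF n] pt_RH by blast
      then show "complex_of_real (lam n j) * f (pt n j) = (\<Sum>k\<in>L. c k * (complex_of_real (lam n j) * TC k (pt n j)))"
        by (simp add: c sum_distrib_left mult.left_commute)
    qed
    also have "\<dots> = (\<Sum>k\<in>L. c k * (\<Sum>j\<in>Lam n. complex_of_real (lam n j) * TC k (pt n j)))"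
      unfolding sum_distrib_left by (rule sum.swap)
    finally show ?thesis
      unfolding cub_def by (simp add: sum_distrib_left mult.left_commute)
  qed
  finally show ?thesis .
qed

theorem theorem4p4:
  fixes n :: nat
  assumes "n \<ge> 1"
  shows "(\<forall>f g. inTC (2*n - 1) (\<lambda>t. f t * cnj (g t)) \<longrightarrow> ip_tri f g = ip_disc n f g)
       \<and> (\<forall>f. inTC (2*n - 1) f \<longrightarrow> avg_tri f = cub n f)
       \<and> (\<forall>k\<in>Lam n. \<forall>j\<in>Lam n. ip_disc n (TC k) (TC j) = (if k = j then 1 / complex_of_real (lam n k) else 0))"
  unfolding ip_tri_def
  using avg_eq_cub[OF assms] ip_disc_TC[OF assms] by (simp add: ip_disc_def)

end
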